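(* The twisted algebra $\mathbb{C}_F[\tilde T]$ has deformed product \[ Z^\mu\bullet Z^\nu=Z^\mu Z^\nu+\tfrac{\imath}{2}\theta^{\mu\nu}_{ab}Z^aZ^b . \] It is isomorphic to the subalgebra $\mathbb{C}_F[\mathrm{GL}_4]^{\mathbb{C}_F[\tilde K]}$ of $\mathbb{C}_F[\mathrm{GL}_4]$, where $F$ is pulled back to $\mathbb{C}[\tilde K]$. Products of generators with $Z^3,Z^4$ are undeformed.
   Context: $\mathbb{C}[\mathrm{GL}_4]$ is the commutative Hopf algebra with generators $a^\mu_\nu$ ($\mu,\nu=1,\dots,4$), matrix coproduct $\Delta a^\mu_\nu=a^\mu_\alpha\otimes a^\alpha_\nu$, and the determinant inverted. Repeated indices are summed. $\mathbb{C}[\tilde T]=\mathbb{C}[Z^1,Z^2,Z^3,Z^4]$ is the polynomial algebra, a left $\mathbb{C}[\mathrm{GL}_4]$-comodule algebra by $\Delta_L(Z^\mu)=a^\mu_\alpha\otimes Z^\alpha$. $\mathbb{C}[\tilde K]=\mathbb{C}[\mathrm{GL}_4]/\langle a^1_1=1,\ a^2_1=a^3_1=a^4_1=0\rangle$, a quotient Hopf algebra with projection $\pi$. Let $\theta^{AB}_{A'B'}$ ($A,B\in\{1,2\}$, $A',B'\in\{3,4\}$) be complex parameters; extend to $\theta^{\mu\alpha}_{\nu\beta}$, set to zero unless $\mu,\alpha\in\{1,2\}$ and $\nu,\beta\in\{3,4\}$. Let $\mathbb{C}[\mathbb{C}^4]$ be the polynomial Hopf algebra on $t^A_{A'}$ with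 additive coproduct and $\partial^{A'}_A$ the dual translation generators (differentiation and evaluation at zero). The 2-cocycle $F(h,g)=\langle\exp(\frac{\imath}{2}\theta^{AB}_{A'B'}\partial^{A'}_A\otimes\partial^{B'}_B),h\otimes g\rangle$ is pulled back to $\mathbb{C}[\mathrm{GL}_4]$ and to $\mathbb{C}[\tilde K]$ along the Hopf algebra map sending $a^A_{A'}\mapsto t^A_{A'}$ for $A\in\{1,2\},A'\in\{3,4\}$, and $a^\mu_\nu\mapsto\delta^\mu_\nu$ for all other entries (this map factors through $\mathbb{C}[\tilde K]$). For $K$ one of these Hopf algebras, $K_F$ (written $\mathbb{C}_F[\cdot]$) has the same coalgebra and product $h\bullet g=F(h_{(1)},g_{(1)})h_{(2)}g_{(2)}F^{-1}(h_{(3)},g_{(3)})$. For a left comodule algebra with coaction $a\mapsto a_{(1)}\otimes a_{(2)}$, the twisted algebra is the same vector space with $a\bullet b=F(a_{(1)},b_{(1)})a_{(2)}b_{(2)}$; this defines $\mathbb{C}_F[\tilde T]$. $\mathbb{C}_F[\mathrm{GL}_4]^{\mathbb{C}_F[\tilde K]}$ denotes the subalgebra of elements invariant under the right coaction $(\mathrm{id}\otimes\pi)\Delta$. Products without $\bullet$ are in the original commutative algebra. *)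

theory Defs
  imports "HOL-Analysis.Analysis" "HOL-Library.Poly_Mapping"
begin

class complex_vector = ab_group_add +
  fixes scaleC :: "complex \<Rightarrow> 'a \<Rightarrow> 'a" (infixr "*\<^sub>C" 75)
  assumes scaleC_add_right: "c *\<^sub>C (x + y) = c *\<^sub>C x + c *\<^sub>C y"
    and scaleC_add_left: "(c + d) *\<^sub>C x = c *\<^sub>C x + d *\<^sub>C x"
    and scaleC_scaleC: "c *\<^sub>C d *\<^sub>C x = (c * d) *\<^sub>C x"
    and scaleC_one: "1 *\<^sub>C x = x"

global_interpretation complex_vector: vector_space "scaleC :: complex \<Rightarrow> 'a \<Rightarrow> 'a::complex_vector"
  by standard (simp_all add: scaleC_add_right scaleC_add_left scaleC_scaleC scaleC_one)

global_interpretation complex_vector_pair: vector_space_pair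
  "scaleC :: complex \<Rightarrow> 'a \<Rightarrow> 'a::complex_vector" "scaleC :: complex \<Rightarrow> 'b \<Rightarrow> 'b::complex_vector"
  by standard

class complex_comm_algebra = complex_vector + comm_ring_1 +
  assumes scaleC_mult_left: "(c *\<^sub>C x) * y = c *\<^sub>C (x * y)"
begin

lemma scaleC_mult_right: "x * (c *\<^sub>C y) = c *\<^sub>C (x * y)"
  by (metis mult.commute scaleC_mult_left)

end

abbreviation clinear :: "('a::complex_vector \<Rightarrow> 'b::complex_vector) \<Rightarrow> bool"
  where "clinear \<equiv> Vector_Spaces.linear scaleC scaleC"

definition cbilinear :: "('a::complex_vector \<Rightarrow> 'b::complex_vector \<Rightarrow> 'c::complex_vector) \<Rightarrow> bool"
  where "cbilinear f \<longleftrightarrow> (\<forall>x. clinear (f x)) \<and> (\<forall>y. clinear (\<lambda>x. f x y))"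

definition algebra_hom :: "('a::complex_comm_algebra \<Rightarrow> 'b::complex_comm_algebra) \<Rightarrow> bool"
  where "algebra_hom f \<longleftrightarrow> clinear f \<and> f 1 = 1 \<and> (\<forall>x y. f (x * y) = f x * f y)"

lemma clinearI:
  assumes "\<And>x y. f (x + y) = f x + f y" "\<And>c x. f (c *\<^sub>C x) = c *\<^sub>C f x"
  shows "clinear f"
  using assms by (simp add: Vector_Spaces.linear_iff complex_vector.vector_space_axioms)

lemmas clinear_add = complex_vector_pair.linear_add
lemmas clinear_scale = complex_vector_pair.linear_scale
lemmas clinear_0 = complex_vector_pair.linear_0
lemmas clinear_diff = complex_vector_pair.linear_diff
lemmas clinear_sum = complex_vector_pair.linear_sum

lemma cbilinearI:
  assumes "\<And>x x' y. f (x + x') y = f x y + f x' y" "\<And>c x y. f (c *\<^sub>C x) y = c *\<^sub>C f x y"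
    "\<And>x y y'. f x (y + y') = f x y + f x y'" "\<And>c x y. f x (c *\<^sub>C y) = c *\<^sub>C f x y"
  shows "cbilinear f"
  using assms by (auto simp: cbilinear_def intro!: clinearI)

lemma cbilinear_simps:
  assumes "cbilinear f"
  shows "f (x + x') y = f x y + f x' y" "f (c *\<^sub>C x) y = c *\<^sub>C f x y"
    "f x (y + y') = f x y + f x y'" "f x (c *\<^sub>C y) = c *\<^sub>C f x y"
proof -
  have *: "clinear (f x)" "clinear (\<lambda>x. f x y)"
    using assms by (auto simp: cbilinear_def)
  show "f (x + x') y = f x y + f x' y" "f (c *\<^sub>C x) y = c *\<^sub>C f x y"
    "f x (y + y') = f x y + f x y'" "f x (c *\<^sub>C y) = c *\<^sub>C f x y"
    using clinear_add[OF *(1)] clinear_add[OF *(2)] clinear_scale[OF *(1)] clinear_scale[OF *(2)]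
    by auto
qed

instantiation complex :: complex_comm_algebra
begin
definition scaleC_complex :: "complex \<Rightarrow> complex \<Rightarrow> complex" where "scaleC_complex c x = c * x"
instance by standard (simp_all add: scaleC_complex_def algebra_simps)
end

text \<open>The ideal generated by \<open>S\<close> is \<open>ideal.span S\<close>. The simp rule removed below would loop with
  associativity.\<close>

global_interpretation ideal: module "(*) :: 'a \<Rightarrow> 'a \<Rightarrow> 'a::comm_ring_1"
  by standard (simp_all add: algebra_simps)

declare ideal.scale_scale [simp del]

instantiation poly_mapping :: (type, complex_vector) complex_vector
begin
definition scaleC_poly_mapping :: "complex \<Rightarrow> ('a \<Rightarrow>\<^sub>0 'b) \<Rightarrow> 'a \<Rightarrow>\<^sub>0 'b"
  where "scaleC_poly_mapping c = Poly_Mapping.map (scaleC c)"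

lemma lookup_scaleC: "Poly_Mapping.lookup (c *\<^sub>C p) k = c *\<^sub>C Poly_Mapping.lookup p k"
  for p :: "'a \<Rightarrow>\<^sub>0 'b"
  by (simp add: scaleC_poly_mapping_def map.rep_eq when_def)

instance
  by standard (rule poly_mapping_eqI, simp add: lookup_scaleC lookup_add scaleC_add_right
      scaleC_add_left scaleC_scaleC scaleC_one)+
end

instance poly_mapping :: (comm_monoid_add, complex_comm_algebra) complex_comm_algebra
proof
  fix c and x y :: "'a \<Rightarrow>\<^sub>0 'b"
  have *: "c *\<^sub>C z = Poly_Mapping.single 0 (c *\<^sub>C 1) * z" for z :: "'a \<Rightarrow>\<^sub>0 'b"
  proof -
    have s: "scaleC c = (*) (c *\<^sub>C (1 :: 'b))"
      by (auto simp: scaleC_mult_left)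
    show ?thesis
      unfolding scaleC_poly_mapping_def by (subst s, rule mult_map_scale_conv_mult)
  qed
  show "(c *\<^sub>C x) * y = c *\<^sub>C (x * y)"
    unfolding *[of x] *[of "x * y"] by (rule mult.assoc)
qed

definition linear_ext :: "('k \<Rightarrow> 'a::complex_vector) \<Rightarrow> ('k \<Rightarrow>\<^sub>0 complex) \<Rightarrow> 'a"
  where "linear_ext w p = (\<Sum>k\<in>Poly_Mapping.keys p. Poly_Mapping.lookup p k *\<^sub>C w k)"

lemma linear_ext_superset:
  assumes "finite S" "Poly_Mapping.keys p \<subseteq> S"
  shows "linear_ext w p = (\<Sum>k\<in>S. Poly_Mapping.lookup p k *\<^sub>C w k)"
  unfolding linear_ext_def using assms
  by (intro sum.mono_neutral_left) (auto simp: in_keys_iff)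

lemma linear_ext_clinear: "clinear (linear_ext w)"
proof (rule clinearI)
  fix p q :: "'a \<Rightarrow>\<^sub>0 complex"
  let ?S = "Poly_Mapping.keys p \<union> Poly_Mapping.keys q"
  have "Poly_Mapping.keys (p + q) \<subseteq> ?S" by (rule keys_add)
  then show "linear_ext w (p + q) = linear_ext w p + linear_ext w q"
    by (simp add: linear_ext_superset[of ?S] lookup_add scaleC_add_left sum.distrib)
next
  fix c and p :: "'a \<Rightarrow>\<^sub>0 complex"
  have "Poly_Mapping.keys (c *\<^sub>C p) \<subseteq> Poly_Mapping.keys p"
    by (auto simp: in_keys_iff lookup_scaleC)
  then show "linear_ext w (c *\<^sub>C p) = c *\<^sub>C linear_ext w p"
    by (simp add: linear_ext_superset[of "Poly_Mapping.keys p"] lookup_scaleC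
        complex_vector.scale_sum_right scaleC_scaleC scaleC_complex_def)
qed

lemma linear_ext_single [simp]: "linear_ext w (Poly_Mapping.single k c) = c *\<^sub>C w k"
  by (simp add: linear_ext_superset[of "{k}"])

lemma poly_mapping_linear_induct:
  fixes p :: "'k \<Rightarrow>\<^sub>0 complex"
  assumes "\<And>k c. P (Poly_Mapping.single k c)" "\<And>p q. P p \<Longrightarrow> P q \<Longrightarrow> P (p + q)"
  shows "P p"
proof -
  have "P (\<Sum>k\<in>S. Poly_Mapping.single k (Poly_Mapping.lookup p k))" if "finite S" for S
    using that
  proof induction
    case empty
    show ?case using assms(1)[of undefined 0] by simp
  next
    case (insert x F)
    then show ?case by (simp add: assms)
  qed
  moreover have "p = (\<Sum>k\<in>Poly_Mapping.keys p. Poly_Mapping.single k (Poly_Mapping.lookup p k))"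
  proof (rule poly_mapping_eqI)
    fix k
    have "(\<Sum>j\<in>Poly_Mapping.keys p. Poly_Mapping.lookup p j when j = k)
        = (\<Sum>j\<in>Poly_Mapping.keys p. if k = j then Poly_Mapping.lookup p j else 0)"
      by (intro sum.cong) (auto simp: when_def)
    also have "\<dots> = Poly_Mapping.lookup p k"
      by (subst sum.delta'[OF finite_keys]) (simp add: in_keys_iff)
    finally show "Poly_Mapping.lookup p k
        = Poly_Mapping.lookup (\<Sum>k\<in>Poly_Mapping.keys p. Poly_Mapping.single k (Poly_Mapping.lookup p k)) k"
      by (simp only: lookup_sum lookup_single)
  qed
  ultimately show ?thesis by (metis finite_keys)
qed

type_synonym 'v mpol = "('v \<Rightarrow>\<^sub>0 nat) \<Rightarrow>\<^sub>0 complex"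

definition mvar :: "'v \<Rightarrow> 'v mpol"
  where "mvar v = Poly_Mapping.single (Poly_Mapping.single v 1) 1"

definition mpol_hom :: "('v \<Rightarrow> 'a::complex_comm_algebra) \<Rightarrow> 'v mpol \<Rightarrow> 'a"
  where "mpol_hom f = linear_ext (\<lambda>m. \<Prod>v\<in>Poly_Mapping.keys m. f v ^ Poly_Mapping.lookup m v)"

definition mpol_deriv :: "'v \<Rightarrow> 'v mpol \<Rightarrow> 'v mpol"
  where "mpol_deriv v = linear_ext (\<lambda>m.
    Poly_Mapping.single (m - Poly_Mapping.single v 1) (of_nat (Poly_Mapping.lookup m v)))"

lemma mpol_hom_mvar [simp]: "mpol_hom f (mvar v) = f v"
  by (simp add: mpol_hom_def mvar_def scaleC_one)

lemma mpol_hom_algebra_hom: "algebra_hom (mpol_hom f)"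
proof -
  let ?w = "\<lambda>m. \<Prod>v\<in>Poly_Mapping.keys m. f v ^ Poly_Mapping.lookup m v"
  have lin: "clinear (mpol_hom f)"
    unfolding mpol_hom_def by (rule linear_ext_clinear)
  have w_sup: "?w m = (\<Prod>v\<in>S. f v ^ Poly_Mapping.lookup m v)"
    if "finite S" "Poly_Mapping.keys m \<subseteq> S" for m S
    using that by (intro prod.mono_neutral_left) (auto simp: in_keys_iff)
  have w_add: "?w (m + n) = ?w m * ?w n" for m n
  proof -
    let ?S = "Poly_Mapping.keys m \<union> Poly_Mapping.keys n"
    have "?w (m + n) = (\<Prod>v\<in>?S. f v ^ Poly_Mapping.lookup (m + n) v)"
      using keys_add[of m n] by (intro w_sup) auto
    also have "\<dots> = ?w m * ?w n"
      by (simp add: w_sup[of ?S m] w_sup[of ?S n] lookup_add power_add prod.distrib)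
    finally show ?thesis .
  qed
  have s: "mpol_hom f (Poly_Mapping.single m c) = c *\<^sub>C ?w m" for m c
    by (simp add: mpol_hom_def)
  have "mpol_hom f (p * q) = mpol_hom f p * mpol_hom f q" for p q
  proof (induction p rule: poly_mapping_linear_induct)
    case (1 m c)
    show ?case
    proof (induction q rule: poly_mapping_linear_induct)
      case (1 n d)
      show ?case
        by (simp add: mult_single s w_add scaleC_mult_left scaleC_mult_right scaleC_scaleC)
    next
      case (2 p q)
      then show ?case by (simp add: distrib_left clinear_add[OF lin])
    qed
  next
    case (2 p p')
    then show ?case by (simp add: distrib_right clinear_add[OF lin])
  qed
  moreover have "mpol_hom f 1 = 1"
    using s[of 0 1] by (simp add: scaleC_one)
  ultimately show ?thesis using lin by (simp add: algebra_hom_def)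
qed

definition tensor_relations :: "(('a::complex_vector \<times> 'b::complex_vector) \<Rightarrow>\<^sub>0 complex) set"
  where "tensor_relations =
    {Poly_Mapping.single (x + x', y) 1 - Poly_Mapping.single (x, y) 1 - Poly_Mapping.single (x', y) 1
      | x x' y. True} \<union>
    {Poly_Mapping.single (x, y + y') 1 - Poly_Mapping.single (x, y) 1 - Poly_Mapping.single (x, y') 1
      | x y y'. True} \<union>
    {Poly_Mapping.single (c *\<^sub>C x, y) 1 - Poly_Mapping.single (x, y) c | c x y. True} \<union>
    {Poly_Mapping.single (x, c *\<^sub>C y) 1 - Poly_Mapping.single (x, y) c | c x y. True}"

definition tensor_rel ::
  "(('a::complex_vector \<times> 'b::complex_vector) \<Rightarrow>\<^sub>0 complex) \<Rightarrow> (('a \<times> 'b) \<Rightarrow>\<^sub>0 complex) \<Rightarrow> bool"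
  where "tensor_rel p q \<longleftrightarrow> p - q \<in> complex_vector.span tensor_relations"

quotient_type (overloaded) ('a, 'b) tensor =
  "('a::complex_vector \<times> 'b::complex_vector) \<Rightarrow>\<^sub>0 complex" / tensor_rel
proof (rule equivpI)
  show "reflp (tensor_rel :: ('a \<times> 'b \<Rightarrow>\<^sub>0 complex) \<Rightarrow> _)"
    by (simp add: reflp_def tensor_rel_def complex_vector.span_zero)
  show "symp (tensor_rel :: ('a \<times> 'b \<Rightarrow>\<^sub>0 complex) \<Rightarrow> _)"
    unfolding symp_def tensor_rel_def by (auto dest: complex_vector.span_neg)
  show "transp (tensor_rel :: ('a \<times> 'b \<Rightarrow>\<^sub>0 complex) \<Rightarrow> _)"
    unfolding transp_def tensor_rel_def by (auto dest: complex_vector.span_add)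
qed

instantiation tensor :: (complex_vector, complex_vector) complex_vector
begin

lift_definition zero_tensor :: "('a, 'b) tensor" is 0 .

lift_definition plus_tensor :: "('a, 'b) tensor \<Rightarrow> ('a, 'b) tensor \<Rightarrow> ('a, 'b) tensor" is "(+)"
  unfolding tensor_rel_def by (simp add: add_diff_add complex_vector.span_add)

lift_definition minus_tensor :: "('a, 'b) tensor \<Rightarrow> ('a, 'b) tensor \<Rightarrow> ('a, 'b) tensor" is "(-)"
proof -
  fix p p' q q' :: "('a \<times> 'b) \<Rightarrow>\<^sub>0 complex"
  assume "tensor_rel p p'" "tensor_rel q q'"
  then have "(p - p') - (q - q') \<in> complex_vector.span tensor_relations"
    unfolding tensor_rel_def by (rule complex_vector.span_diff)
  also have "(p - p') - (q - q') = (p - q) - (p' - q')" by simp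
  finally show "tensor_rel (p - q) (p' - q')" by (simp only: tensor_rel_def)
qed

lift_definition uminus_tensor :: "('a, 'b) tensor \<Rightarrow> ('a, 'b) tensor" is uminus
  unfolding tensor_rel_def by (subst minus_diff_minus, rule complex_vector.span_neg)

lift_definition scaleC_tensor :: "complex \<Rightarrow> ('a, 'b) tensor \<Rightarrow> ('a, 'b) tensor" is scaleC
  unfolding tensor_rel_def
  by (simp only: complex_vector.span_scale complex_vector.scale_right_diff_distrib[symmetric])

lemma tensor_rel_refl: "tensor_rel p p"
  by (simp add: tensor_rel_def complex_vector.span_zero)

instance
  by standard (transfer, simp add: tensor_rel_refl algebra_simps scaleC_add_right scaleC_add_left
      scaleC_scaleC scaleC_one)+

end

lift_definition pure_tensor :: "'a::complex_vector \<Rightarrow> 'b::complex_vector \<Rightarrow> ('a, 'b) tensor"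
    (infixr "\<otimes>" 72)
  is "\<lambda>x y. Poly_Mapping.single (x, y) 1" .

text \<open>The linear map on the tensor product induced by a bilinear \<open>f\<close>; it serves to evaluate
  Sweedler-type expressions. (Only meaningful when \<open>f\<close> is bilinear.)\<close>

definition tensor_lift ::
  "('a::complex_vector \<Rightarrow> 'b::complex_vector \<Rightarrow> 'c::complex_vector) \<Rightarrow> ('a, 'b) tensor \<Rightarrow> 'c"
  where "tensor_lift f t = linear_ext (\<lambda>(x, y). f x y) (rep_tensor t)"

definition tensor_map ::
  "('a::complex_vector \<Rightarrow> 'c::complex_vector) \<Rightarrow> ('b::complex_vector \<Rightarrow> 'd::complex_vector)
    \<Rightarrow> ('a, 'b) tensor \<Rightarrow> ('c, 'd) tensor"
  where "tensor_map f g = tensor_lift (\<lambda>x y. f x \<otimes> g y)"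

lemma pure_tensor_add_left: "(x + x') \<otimes> y = x \<otimes> y + x' \<otimes> y"
  by transfer (unfold tensor_rel_def tensor_relations_def, rule complex_vector.span_base,
      unfold diff_diff_add, blast)

lemma pure_tensor_add_right: "x \<otimes> (y + y') = x \<otimes> y + x \<otimes> y'"
  by transfer (unfold tensor_rel_def tensor_relations_def, rule complex_vector.span_base,
      unfold diff_diff_add, blast)

lemma scaleC_single: "c *\<^sub>C Poly_Mapping.single k d = Poly_Mapping.single k (c *\<^sub>C d)"
  by (rule poly_mapping_eqI) (simp add: lookup_scaleC lookup_single when_def)

lemma pure_tensor_scaleC_left: "(c *\<^sub>C x) \<otimes> y = c *\<^sub>C (x \<otimes> y)"
  by transfer (unfold tensor_rel_def tensor_relations_def, rule complex_vector.span_base,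
      simp add: scaleC_single scaleC_complex_def, blast)

lemma pure_tensor_scaleC_right: "x \<otimes> (c *\<^sub>C y) = c *\<^sub>C (x \<otimes> y)"
  by transfer (unfold tensor_rel_def tensor_relations_def, rule complex_vector.span_base,
      simp add: scaleC_single scaleC_complex_def, blast)

lemma cbilinear_pure_tensor: "cbilinear (\<otimes>)"
  by (intro cbilinearI pure_tensor_add_left pure_tensor_add_right pure_tensor_scaleC_left
      pure_tensor_scaleC_right)

lemma tensor_induct [case_names pure add]:
  assumes "\<And>x y. P (x \<otimes> y)" "\<And>s t. P s \<Longrightarrow> P t \<Longrightarrow> P (s + t)"
  shows "P t"
proof -
  have "P (abs_tensor p)" for p
  proof (induction p rule: poly_mapping_linear_induct)
    case (1 k c)
    have "abs_tensor (Poly_Mapping.single k c) = c *\<^sub>C (fst k \<otimes> snd k)"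
      by (simp add: pure_tensor.abs_eq scaleC_tensor.abs_eq scaleC_single scaleC_complex_def)
    also have "\<dots> = (c *\<^sub>C fst k) \<otimes> snd k"
      by (rule pure_tensor_scaleC_left[symmetric])
    finally have "abs_tensor (Poly_Mapping.single k c) = (c *\<^sub>C fst k) \<otimes> snd k" .
    then show ?case using assms(1) by simp
  next
    case (2 p q)
    then show ?case using assms(2) by (simp add: plus_tensor.abs_eq[symmetric])
  qed
  then show ?thesis by (metis Quotient_tensor Quotient_abs_rep)
qed

lemma tensor_lift_abs:
  assumes "cbilinear f"
  shows "tensor_lift f (abs_tensor p) = linear_ext (\<lambda>(x, y). f x y) p"
proof -
  let ?L = "linear_ext (\<lambda>(x, y). f x y)"
  have lin: "clinear ?L" by (rule linear_ext_clinear)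
  have l1: "clinear (f x)" and l2: "clinear (\<lambda>x. f x y)" for x y
    using assms by (auto simp: cbilinear_def)
  have zero: "?L r = 0" if "r \<in> complex_vector.span tensor_relations"
    for r :: "('a \<times> 'b) \<Rightarrow>\<^sub>0 complex"
    using that
  proof (induction rule: complex_vector.span_induct)
    show "complex_vector.subspace {r. ?L r = 0}"
      by (rule complex_vector.subspaceI)
        (auto simp: clinear_0[OF lin] clinear_add[OF lin] clinear_scale[OF lin])
  next
    fix r :: "('a \<times> 'b) \<Rightarrow>\<^sub>0 complex"
    assume "r \<in> tensor_relations"
    then show "?L r = 0"
      by (auto simp: tensor_relations_def clinear_diff[OF lin] scaleC_one
          clinear_add[OF l1] clinear_add[OF l2] clinear_scale[OF l1] clinear_scale[OF l2])
  qed
  have "tensor_rel (rep_tensor (abs_tensor p)) p"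
    by (simp add: Quotient3_rep_abs[OF Quotient3_tensor] tensor_rel_refl)
  then show ?thesis
    using zero unfolding tensor_lift_def tensor_rel_def
    by (metis clinear_diff lin right_minus_eq)
qed

lemma tensor_lift_pure [simp]: "cbilinear f \<Longrightarrow> tensor_lift f (x \<otimes> y) = f x y"
  by (simp add: pure_tensor.abs_eq tensor_lift_abs scaleC_one)

lemma tensor_lift_clinear:
  assumes "cbilinear f"
  shows "clinear (tensor_lift f)"
proof (rule clinearI)
  fix s t :: "('a, 'b) tensor"
  obtain p q where "s = abs_tensor p" "t = abs_tensor q"
    by (metis Quotient_tensor Quotient_abs_rep)
  then show "tensor_lift f (s + t) = tensor_lift f s + tensor_lift f t"
    by (simp add: plus_tensor.abs_eq tensor_lift_abs[OF assms] clinear_add[OF linear_ext_clinear])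
next
  fix c and s :: "('a, 'b) tensor"
  obtain p where "s = abs_tensor p" by (metis Quotient_tensor Quotient_abs_rep)
  then show "tensor_lift f (c *\<^sub>C s) = c *\<^sub>C tensor_lift f s"
    by (simp add: scaleC_tensor.abs_eq tensor_lift_abs[OF assms] clinear_scale[OF linear_ext_clinear])
qed

lemma cbilinear_comp:
  assumes "cbilinear f" "clinear g" "clinear h"
  shows "cbilinear (\<lambda>x y. f (g x) (h y))"
  by (rule cbilinearI)
    (simp_all add: clinear_add[OF assms(2)] clinear_add[OF assms(3)] clinear_scale[OF assms(2)]
      clinear_scale[OF assms(3)] cbilinear_simps[OF assms(1)])

lemma tensor_map_clinear: "clinear f \<Longrightarrow> clinear g \<Longrightarrow> clinear (tensor_map f g)"
  unfolding tensor_map_def 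
  by (rule tensor_lift_clinear, rule cbilinear_comp[OF cbilinear_pure_tensor])

lemma tensor_map_pure: "clinear f \<Longrightarrow> clinear g \<Longrightarrow> tensor_map f g (x \<otimes> y) = f x \<otimes> g y"
  unfolding tensor_map_def 
  by (rule tensor_lift_pure, rule cbilinear_comp[OF cbilinear_pure_tensor])

lemma clinear_mult: "clinear ((*) x)" "clinear (\<lambda>y. y * x)"
  for x :: "'a::complex_comm_algebra"
  by (rule clinearI; simp add: algebra_simps scaleC_mult_left scaleC_mult_right)+

lemma exists_functional:
  fixes x :: "'a::complex_vector"
  assumes "x \<noteq> 0"
  obtains f :: "'a \<Rightarrow> complex" where "clinear f" "f x = 1"
proof -
  have "complex_vector.independent {x}" using assms by simp
  then show ?thesis
    using complex_vector_pair.linear_independent_extend[of "{x}" "\<lambda>_. 1 :: complex"] that by auto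
qed

instantiation tensor :: (complex_comm_algebra, complex_comm_algebra) complex_comm_algebra
begin

definition one_tensor :: "('a, 'b) tensor" where "one_tensor = 1 \<otimes> 1"

definition times_tensor :: "('a, 'b) tensor \<Rightarrow> ('a, 'b) tensor \<Rightarrow> ('a, 'b) tensor"
  where "times_tensor s t = tensor_lift (\<lambda>a b. tensor_lift (\<lambda>c d. (a * c) \<otimes> (b * d)) t) s"

lemma tensor_times_bilinear: "cbilinear (\<lambda>c d. (a * c) \<otimes> (b * d))"
  for a :: 'a and b :: 'b
  by (rule cbilinear_comp[OF cbilinear_pure_tensor clinear_mult(1) clinear_mult(1)])

lemma tensor_times_bilinear': "cbilinear (\<lambda>a b. tensor_lift (\<lambda>c d. (a * c) \<otimes> (b * d)) t)"
  for t :: "('a, 'b) tensor"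
proof (induction t rule: tensor_induct)
  case (pure x y)
  have "cbilinear (\<lambda>a b. (a * x) \<otimes> (b * y))"
    by (rule cbilinear_comp[OF cbilinear_pure_tensor clinear_mult(2) clinear_mult(2)])
  then show ?case by (simp add: tensor_times_bilinear)
next
  case (add s t)
  then show ?case
    by (simp add: clinear_add[OF tensor_lift_clinear[OF tensor_times_bilinear]])
      (rule cbilinearI; simp add: cbilinear_simps[OF add(1)] cbilinear_simps[OF add(2)]
        scaleC_add_right)
qed

lemma tensor_times_pure: "(a \<otimes> b) * (c \<otimes> d) = (a * c) \<otimes> (b * d)"
  for a c :: 'a and b d :: 'b
  unfolding times_tensor_def
  by (subst tensor_lift_pure[OF tensor_times_bilinear']) (rule tensor_lift_pure[OF tensor_times_bilinear])

lemma pure_tensor_times: "(a \<otimes> b) * t = tensor_lift (\<lambda>c d. (a * c) \<otimes> (b * d)) t"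
  for a :: 'a and b :: 'b
  unfolding times_tensor_def by (rule tensor_lift_pure[OF tensor_times_bilinear'])

lemma tensor_times_clinear: "clinear (\<lambda>s. s * t)"
  for t :: "('a, 'b) tensor"
  unfolding times_tensor_def by (rule tensor_lift_clinear[OF tensor_times_bilinear'])

lemma tensor_times_commute: "s * t = t * s" for s t :: "('a, 'b) tensor"
proof (induction s rule: tensor_induct)
  case (pure a b)
  have "clinear ((*) (a \<otimes> b))"
    unfolding pure_tensor_times by (rule tensor_lift_clinear[OF tensor_times_bilinear])
  note lin = clinear_add[OF this]
  show ?case
  proof (induction t rule: tensor_induct)
    case (pure c d)
    show ?case by (simp add: tensor_times_pure mult.commute)
  next
    case (add t t')
    then show ?case by (simp add: lin clinear_add[OF tensor_times_clinear])
  qed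
next
  case (add s s')
  have "clinear ((*) t)"
  proof (rule clinearI)
    show "t * (x + y) = t * x + t * y" for x y
    proof (induction t rule: tensor_induct)
      case (pure a b)
      show ?case
        by (simp only: pure_tensor_times clinear_add[OF tensor_lift_clinear[OF tensor_times_bilinear]])
    next
      case (add t t')
      then show ?case by (simp add: clinear_add[OF tensor_times_clinear])
    qed
    show "t * (c *\<^sub>C x) = c *\<^sub>C (t * x)" for c x
    proof (induction t rule: tensor_induct)
      case (pure a b)
      show ?case
        by (simp only: pure_tensor_times clinear_scale[OF tensor_lift_clinear[OF tensor_times_bilinear]])
    next
      case (add t t')
      then show ?case by (simp add: clinear_add[OF tensor_times_clinear] scaleC_add_right)
    qed
  qed
  then show ?case
    using add by (simp add: clinear_add clinear_add[OF tensor_times_clinear])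
qed

instance
proof
  fix r s t :: "('a, 'b) tensor" and c :: complex
  note add_left = clinear_add[OF tensor_times_clinear]
  have add_right: "u * (v + w) = u * v + u * w" for u v w :: "('a, 'b) tensor"
    by (metis add_left tensor_times_commute)
  show "r * s = s * r" by (rule tensor_times_commute)
  show "(r + s) * t = r * t + s * t" by (rule add_left)
  show "(c *\<^sub>C s) * t = c *\<^sub>C (s * t)" by (rule clinear_scale[OF tensor_times_clinear])
  have assoc1: "((a \<otimes> b) * (a' \<otimes> b')) * u = (a \<otimes> b) * ((a' \<otimes> b') * u)"
    for a a' :: 'a and b b' :: 'b and u
  proof (induction u rule: tensor_induct)
    case (pure x y)
    show ?case by (simp only: tensor_times_pure mult.assoc)
  next
    case (add u v)
    show ?case by (simp only: add_right add)
  qed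
  have assoc2: "((a \<otimes> b) * u) * t = (a \<otimes> b) * (u * t)" for a :: 'a and b :: 'b and u
  proof (induction u rule: tensor_induct)
    case (pure x y)
    show ?case by (rule assoc1)
  next
    case (add u v)
    show ?case by (simp only: add_left add_right add)
  qed
  show "r * s * t = r * (s * t)"
  proof (induction r rule: tensor_induct)
    case (pure x y)
    show ?case by (rule assoc2)
  next
    case (add u v)
    show ?case by (simp only: add_left add)
  qed
  show "1 * s = s"
  proof (induction s rule: tensor_induct)
    case (pure x y)
    show ?case by (simp only: one_tensor_def tensor_times_pure mult_1)
  next
    case (add u v)
    show ?case by (simp only: add_right add)
  qed
  obtain f :: "'a \<Rightarrow> complex" where f: "clinear f" "f 1 = 1"
    using exists_functional[of "1 :: 'a"] by auto
  obtain g :: "'b \<Rightarrow> complex" where g: "clinear g" "g 1 = 1"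
    using exists_functional[of "1 :: 'b"] by auto
  have b: "cbilinear (\<lambda>a b. f a * g b)"
    by (rule cbilinearI)
      (simp_all only: clinear_add[OF f(1)] clinear_add[OF g(1)] clinear_scale[OF f(1)]
        clinear_scale[OF g(1)] scaleC_mult_left scaleC_mult_right distrib_left distrib_right)
  have "tensor_lift (\<lambda>a b. f a * g b) 0 = 0"
    by (rule clinear_0[OF tensor_lift_clinear[OF b]])
  moreover have "tensor_lift (\<lambda>a b. f a * g b) 1 = 1"
    using b f g by (simp add: one_tensor_def)
  ultimately show "(0 :: ('a, 'b) tensor) \<noteq> 1" by fastforce
qed

end

lemma algebra_homD:
  assumes "algebra_hom f"
  shows "clinear f" "f 1 = 1" "f (x * y) = f x * f y" "f (x + y) = f x + f y"
    "f (x - y) = f x - f y" "f 0 = 0" "f (c *\<^sub>C x) = c *\<^sub>C f x"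
  using assms clinear_add[of f] clinear_diff[of f] clinear_0[of f] clinear_scale[of f]
  by (auto simp: algebra_hom_def)

lemma algebra_hom_tensor_map:
  assumes "algebra_hom f" "algebra_hom g"
  shows "algebra_hom (tensor_map f g)"
proof -
  note lin = tensor_map_clinear[OF assms[THEN algebra_homD(1)]]
  note pure = tensor_map_pure[OF assms[THEN algebra_homD(1)]]
  have "tensor_map f g (s * t) = tensor_map f g s * tensor_map f g t" for s t
  proof (induction s rule: tensor_induct)
    case (pure a b)
    show ?case
      by (induction t rule: tensor_induct)
        (simp_all add: tensor_times_pure tensor_map_pure assms algebra_homD distrib_left clinear_add[OF lin])
  qed (simp add: distrib_right clinear_add[OF lin])
  then show ?thesis
    using lin by (simp add: algebra_hom_def one_tensor_def pure assms[THEN algebra_homD(2)])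
qed

lemma algebra_hom_det:
  fixes A :: "'a::complex_comm_algebra^'n^'n"
  assumes "algebra_hom f"
  shows "det (\<chi> i j. f (A $ i $ j)) = f (det A)"
proof -
  have add: "f (x + y) = f x + f y" and m: "f (x * y) = f x * f y" and o: "f 1 = 1" and z: "f 0 = 0"
    and d: "f (x - y) = f x - f y" for x y
    by (rule algebra_homD[OF assms])+
  have sum: "f (sum h S) = (\<Sum>x\<in>S. f (h x))" for h :: "('n \<Rightarrow> 'n) \<Rightarrow> 'a" and S
    by (induction S rule: infinite_finite_induct) (auto simp: add z)
  have prod: "f (prod h S) = (\<Prod>x\<in>S. f (h x))" for h :: "'n \<Rightarrow> 'a" and S
    by (induction S rule: infinite_finite_induct) (auto simp: m o)
  have "f (of_int (sign p)) = of_int (sign p)" for p :: "'n \<Rightarrow> 'n"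
    using d[of 0 1] by (auto simp: sign_def z o)
  then show ?thesis
    by (simp add: det_def sum m prod)
qed

lemma ideal_mult_cong:
  assumes "p - p' \<in> ideal.span S" "q - q' \<in> ideal.span S"
  shows "p * q - p' * q' \<in> ideal.span S"
proof -
  have "p * q - p' * q' = p * (q - q') + q' * (p - p')" by (simp add: algebra_simps)
  then show ?thesis using assms by (simp add: ideal.span_add ideal.span_scale)
qed

lemma ideal_minus_cong:
  assumes "p - p' \<in> ideal.span S" "q - q' \<in> ideal.span S"
  shows "(p - q) - (p' - q') \<in> ideal.span S"
proof -
  have "(p - q) - (p' - q') = (p - p') - (q - q')" by simp
  then show ?thesis using assms by (simp only: ideal.span_diff)
qed

lemma ideal_scaleC_cong:
  fixes p :: "'a::complex_comm_algebra"
  assumes "p - p' \<in> ideal.span S"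
  shows "c *\<^sub>C p - c *\<^sub>C p' \<in> ideal.span S"
proof -
  have "c *\<^sub>C p - c *\<^sub>C p' = (c *\<^sub>C 1) * (p - p')"
    by (simp add: scaleC_mult_left complex_vector.scale_right_diff_distrib)
  then show ?thesis using assms by (simp only: ideal.span_scale)
qed

lemma ideal_equivp: "equivp (\<lambda>p q. p - q \<in> ideal.span S)"
proof (rule equivpI)
  show "reflp (\<lambda>p q. p - q \<in> ideal.span S)" by (simp add: reflp_def ideal.span_zero)
  show "symp (\<lambda>p q. p - q \<in> ideal.span S)"
    unfolding symp_def by (auto dest: ideal.span_neg)
  show "transp (\<lambda>p q. p - q \<in> ideal.span S)"
    unfolding transp_def by (auto dest: ideal.span_add)
qed

lemma algebra_hom_ideal:
  assumes "algebra_hom f" "\<And>x. x \<in> S \<Longrightarrow> f x = 0" "p - q \<in> ideal.span S"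
  shows "f p = f q"
proof -
  have "f r = 0" if "r \<in> ideal.span S" for r
    using that
  proof (induction rule: ideal.span_induct)
    show "ideal.subspace {r. f r = 0}"
      by (rule ideal.subspaceI) (auto simp: algebra_homD[OF assms(1)])
  qed (simp add: assms(2))
  then show ?thesis using assms(3) by (metis algebra_homD(5)[OF assms(1)] right_minus_eq)
qed

text \<open>The indices range over the type \<open>4\<close>, whose elements are \<open>1, 2, 3, 4\<close> (with \<open>4 = 0\<close>). The
  determinant is inverted by adjoining a further variable.\<close>

datatype gl_var = Entry 4 4 | DetInv

definition gl_ideal :: "gl_var mpol set"
  where "gl_ideal = ideal.span {mvar DetInv * det (\<chi> \<mu> \<nu>. mvar (Entry \<mu> \<nu>)) - 1}"

quotient_type gl4 = "gl_var mpol" / "\<lambda>p q. p - q \<in> gl_ideal"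
  unfolding gl_ideal_def by (rule ideal_equivp)

instantiation gl4 :: complex_comm_algebra
begin

lift_definition zero_gl4 :: gl4 is 0 .
lift_definition one_gl4 :: gl4 is 1 .
lift_definition plus_gl4 :: "gl4 \<Rightarrow> gl4 \<Rightarrow> gl4" is "(+)"
  unfolding gl_ideal_def by (simp add: add_diff_add ideal.span_add)
lift_definition minus_gl4 :: "gl4 \<Rightarrow> gl4 \<Rightarrow> gl4" is "(-)"
  unfolding gl_ideal_def by (rule ideal_minus_cong)
lift_definition uminus_gl4 :: "gl4 \<Rightarrow> gl4" is uminus
  unfolding gl_ideal_def by (subst minus_diff_minus, rule ideal.span_neg)
lift_definition times_gl4 :: "gl4 \<Rightarrow> gl4 \<Rightarrow> gl4" is "(*)"
  unfolding gl_ideal_def by (rule ideal_mult_cong)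
lift_definition scaleC_gl4 :: "complex \<Rightarrow> gl4 \<Rightarrow> gl4" is scaleC
  unfolding gl_ideal_def by (rule ideal_scaleC_cong)

lemma gl_ideal_0: "0 \<in> gl_ideal"
  by (simp add: gl_ideal_def ideal.span_zero)

lemma gl_ideal_1: "- 1 \<notin> gl_ideal"
proof
  assume "- 1 \<in> gl_ideal"
  let ?w = "\<lambda>v. case v of Entry \<mu> \<nu> \<Rightarrow> if \<mu> = \<nu> then 1 else 0 :: complex | DetInv \<Rightarrow> 1"
  note hom = mpol_hom_algebra_hom[of ?w]
  have "mpol_hom ?w (det (\<chi> \<mu> \<nu>. mvar (Entry \<mu> \<nu>))) = det (mat 1 :: complex^4^4)"
    by (subst algebra_hom_det[OF hom, symmetric]) (simp add: mat_def)
  then have "mpol_hom ?w (mvar DetInv * det (\<chi> \<mu> \<nu>. mvar (Entry \<mu> \<nu>)) - 1) = 0"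
    by (simp add: algebra_homD[OF hom])
  then have "mpol_hom ?w 0 = mpol_hom ?w 1"
    using \<open>- 1 \<in> gl_ideal\<close> unfolding gl_ideal_def by (intro algebra_hom_ideal[OF hom]) auto
  then show False by (simp add: algebra_homD[OF hom])
qed

instance
proof
  fix x y z :: gl4 and c d :: complex
  obtain p q r where r: "x = abs_gl4 p" "y = abs_gl4 q" "z = abs_gl4 r"
    by (metis Quotient_gl4 Quotient_abs_rep)
  note abs = r plus_gl4.abs_eq times_gl4.abs_eq minus_gl4.abs_eq uminus_gl4.abs_eq scaleC_gl4.abs_eq
    zero_gl4.abs_eq one_gl4.abs_eq
  show "x + y + z = x + (y + z)" by (simp only: abs add.assoc)
  show "x + y = y + x" by (simp only: abs add.commute)
  show "0 + x = x" by (simp only: abs add_0)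
  show "- x + x = 0" by (simp only: abs left_minus)
  show "x - y = x + - y" by (simp only: abs diff_conv_add_uminus)
  show "c *\<^sub>C (x + y) = c *\<^sub>C x + c *\<^sub>C y" by (simp only: abs scaleC_add_right)
  show "(c + d) *\<^sub>C x = c *\<^sub>C x + d *\<^sub>C x" by (simp only: abs scaleC_add_left)
  show "c *\<^sub>C d *\<^sub>C x = (c * d) *\<^sub>C x" by (simp only: abs scaleC_scaleC)
  show "1 *\<^sub>C x = x" by (simp only: abs scaleC_one)
  show "x * y * z = x * (y * z)" by (simp only: abs mult.assoc)
  show "x * y = y * x" by (simp only: abs mult.commute)
  show "1 * x = x" by (simp only: abs mult_1)
  show "(x + y) * z = x * z + y * z" by (simp only: abs distrib_right)
  show "(c *\<^sub>C x) * y = c *\<^sub>C (x * y)" by (simp only: abs scaleC_mult_left)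
  show "(0 :: gl4) \<noteq> 1"
    by (simp add: zero_gl4.abs_eq one_gl4.abs_eq gl4.abs_eq_iff gl_ideal_1)
qed

end

lift_definition gl_entry :: "4 \<Rightarrow> 4 \<Rightarrow> gl4" is "\<lambda>\<mu> \<nu>. mvar (Entry \<mu> \<nu>)" .
lift_definition gl_det_inv :: gl4 is "mvar DetInv" .

text \<open>The algebra homomorphism sending the generator matrix to \<open>M\<close>
  (only meaningful when \<open>det M\<close> is invertible).\<close>

definition gl_hom :: "'a::complex_comm_algebra^4^4 \<Rightarrow> gl4 \<Rightarrow> 'a"
  where "gl_hom M x = mpol_hom
    (\<lambda>v. case v of Entry \<mu> \<nu> \<Rightarrow> M $ \<mu> $ \<nu> | DetInv \<Rightarrow> (THE u. u * det M = 1)) (rep_gl4 x)"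

lemma gl_hom_abs:
  assumes "u * det M = 1"
  shows "gl_hom M (abs_gl4 p) = mpol_hom (case_gl_var (\<lambda>\<mu> \<nu>. M $ \<mu> $ \<nu>) u) p"
proof -
  have "v = u" if "v * det M = 1" for v
    using assms that by (metis mult.commute mult.left_commute mult_1_right)
  then have u: "(THE u. u * det M = 1) = u" using assms by blast
  let ?w = "case_gl_var (\<lambda>\<mu> \<nu>. M $ \<mu> $ \<nu>) u"
  note hom = mpol_hom_algebra_hom[of ?w]
  have "mpol_hom ?w (det (\<chi> \<mu> \<nu>. mvar (Entry \<mu> \<nu>))) = det M"
    by (subst algebra_hom_det[OF hom, symmetric]) (simp add: vec_nth_inverse)
  then have "mpol_hom ?w (mvar DetInv * det (\<chi> \<mu> \<nu>. mvar (Entry \<mu> \<nu>)) - 1) = 0"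
    using assms by (simp add: algebra_homD[OF hom])
  moreover have "rep_gl4 (abs_gl4 p) - p \<in> gl_ideal"
    using Quotient3_rep_abs[OF Quotient3_gl4, of p] gl_ideal_0 by simp
  ultimately show ?thesis
    unfolding gl_hom_def u gl_ideal_def by (intro algebra_hom_ideal[OF hom]) auto
qed

lemma gl_hom_algebra_hom:
  assumes "u * det M = 1"
  shows "algebra_hom (gl_hom M)"
proof -
  have *: "\<exists>p. x = abs_gl4 p" for x by (metis Quotient_gl4 Quotient_abs_rep)
  note hom = algebra_homD[OF mpol_hom_algebra_hom[of "case_gl_var (\<lambda>\<mu> \<nu>. M $ \<mu> $ \<nu>) u"]]
  note abs = gl_hom_abs[OF assms]
  have "gl_hom M (x + y) = gl_hom M x + gl_hom M y" "gl_hom M (x * y) = gl_hom M x * gl_hom M y"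
    "gl_hom M (c *\<^sub>C x) = c *\<^sub>C gl_hom M x" for x y c
    using *[of x] *[of y]
    by (auto simp: abs hom plus_gl4.abs_eq times_gl4.abs_eq scaleC_gl4.abs_eq)
  moreover have "gl_hom M 1 = 1" by (simp add: one_gl4.abs_eq abs hom)
  ultimately show ?thesis by (auto simp: algebra_hom_def intro: clinearI)
qed

lemma gl_hom_entry: "u * det M = 1 \<Longrightarrow> gl_hom M (gl_entry \<mu> \<nu>) = M $ \<mu> $ \<nu>"
  by (simp add: gl_entry.abs_eq gl_hom_abs)

definition gl_comult :: "gl4 \<Rightarrow> (gl4, gl4) tensor"
  where "gl_comult = gl_hom (\<chi> \<mu> \<nu>. \<Sum>\<alpha>\<in>UNIV. gl_entry \<mu> \<alpha> \<otimes> gl_entry \<alpha> \<nu>)"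

definition gl_counit :: "gl4 \<Rightarrow> complex"
  where "gl_counit = gl_hom (mat 1)"

lemma gl_det_inv: "gl_det_inv * det (\<chi> \<mu> \<nu>. gl_entry \<mu> \<nu>) = 1"
proof -
  have hom: "algebra_hom abs_gl4"
    unfolding algebra_hom_def
    by (auto intro!: clinearI simp: plus_gl4.abs_eq times_gl4.abs_eq scaleC_gl4.abs_eq one_gl4.abs_eq)
  have "abs_gl4 (mvar DetInv * det (\<chi> \<mu> \<nu>. mvar (Entry \<mu> \<nu>))) = abs_gl4 1"
    by (simp add: gl4.abs_eq_iff gl_ideal_def ideal.span_base)
  then show ?thesis
    using algebra_hom_det[OF hom, of "\<chi> \<mu> \<nu>. mvar (Entry \<mu> \<nu>)"]
    by (simp add: algebra_homD[OF hom] gl_entry.abs_eq gl_det_inv.abs_eq)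
qed

lemma gl_comult_det:
  "(gl_det_inv \<otimes> gl_det_inv) * det (\<chi> \<mu> \<nu>. \<Sum>\<alpha>\<in>UNIV. gl_entry \<mu> \<alpha> \<otimes> gl_entry \<alpha> \<nu>) = 1"
proof -
  let ?A = "\<chi> \<mu> \<nu>. gl_entry \<mu> \<nu>"
  have l: "algebra_hom (\<lambda>x. x \<otimes> (1 :: gl4))" and r: "algebra_hom (\<lambda>x. (1 :: gl4) \<otimes> x)"
    by (auto simp: algebra_hom_def one_tensor_def tensor_times_pure pure_tensor_add_left
        pure_tensor_add_right pure_tensor_scaleC_left pure_tensor_scaleC_right intro!: clinearI)
  have "(\<chi> \<mu> \<nu>. \<Sum>\<alpha>\<in>UNIV. gl_entry \<mu> \<alpha> \<otimes> gl_entry \<alpha> \<nu>)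
      = (\<chi> \<mu> \<nu>. ?A $ \<mu> $ \<nu> \<otimes> (1 :: gl4)) ** (\<chi> \<mu> \<nu>. (1 :: gl4) \<otimes> ?A $ \<mu> $ \<nu>)"
    by (simp add: matrix_matrix_mult_def tensor_times_pure)
  then have "det (\<chi> \<mu> \<nu>. \<Sum>\<alpha>\<in>UNIV. gl_entry \<mu> \<alpha> \<otimes> gl_entry \<alpha> \<nu>) = det ?A \<otimes> det ?A"
    by (simp add: det_mul algebra_hom_det[OF l, of ?A, simplified] algebra_hom_det[OF r, of ?A, simplified] tensor_times_pure)
  then show ?thesis by (simp add: tensor_times_pure gl_det_inv one_tensor_def)
qed

lemmas gl_comult_algebra_hom = gl_hom_algebra_hom[OF gl_comult_det, folded gl_comult_def]

lemma gl_comult_entry: "gl_comult (gl_entry \<mu> \<nu>) = (\<Sum>\<alpha>\<in>UNIV. gl_entry \<mu> \<alpha> \<otimes> gl_entry \<alpha> \<nu>)"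
  unfolding gl_comult_def by (simp add: gl_hom_entry[OF gl_comult_det])

lemma gl_counit_algebra_hom: "algebra_hom gl_counit"
  unfolding gl_counit_def by (rule gl_hom_algebra_hom[of 1]) simp

lemma gl_counit_entry: "gl_counit (gl_entry \<mu> \<nu>) = (if \<mu> = \<nu> then 1 else 0)"
  unfolding gl_counit_def by (subst gl_hom_entry[of 1]) (simp, simp add: mat_def)

definition k_ideal :: "gl4 set"
  where "k_ideal = ideal.span {gl_entry 1 1 - 1, gl_entry 2 1, gl_entry 3 1, gl_entry 4 1}"

quotient_type ktilde = gl4 / "\<lambda>x y. x - y \<in> k_ideal"
  morphisms rep_ktilde k_proj
  unfolding k_ideal_def by (rule ideal_equivp)

instantiation ktilde :: complex_comm_algebra
begin

lift_definition zero_ktilde :: ktilde is 0 .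
lift_definition one_ktilde :: ktilde is 1 .
lift_definition plus_ktilde :: "ktilde \<Rightarrow> ktilde \<Rightarrow> ktilde" is "(+)"
  unfolding k_ideal_def by (simp add: add_diff_add ideal.span_add)
lift_definition minus_ktilde :: "ktilde \<Rightarrow> ktilde \<Rightarrow> ktilde" is "(-)"
  unfolding k_ideal_def by (rule ideal_minus_cong)
lift_definition uminus_ktilde :: "ktilde \<Rightarrow> ktilde" is uminus
  unfolding k_ideal_def by (subst minus_diff_minus, rule ideal.span_neg)
lift_definition times_ktilde :: "ktilde \<Rightarrow> ktilde \<Rightarrow> ktilde" is "(*)"
  unfolding k_ideal_def by (rule ideal_mult_cong)
lift_definition scaleC_ktilde :: "complex \<Rightarrow> ktilde \<Rightarrow> ktilde" is scaleC
  unfolding k_ideal_def by (rule ideal_scaleC_cong)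

lemma k_ideal_0: "0 \<in> k_ideal"
  by (simp add: k_ideal_def ideal.span_zero)

lemma k_ideal_1: "- 1 \<notin> k_ideal"
proof
  assume "- 1 \<in> k_ideal"
  then have "gl_counit 0 = gl_counit 1"
    unfolding k_ideal_def
    by (intro algebra_hom_ideal[OF gl_counit_algebra_hom])
      (auto simp: algebra_homD[OF gl_counit_algebra_hom] gl_counit_entry)
  then show False by (simp add: algebra_homD[OF gl_counit_algebra_hom])
qed

instance
proof
  fix x y z :: ktilde and c d :: complex
  obtain p q r where r: "x = k_proj p" "y = k_proj q" "z = k_proj r"
    by (metis Quotient_ktilde Quotient_abs_rep)
  note abs = r plus_ktilde.abs_eq times_ktilde.abs_eq minus_ktilde.abs_eq uminus_ktilde.abs_eq scaleC_ktilde.abs_eq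
    zero_ktilde.abs_eq one_ktilde.abs_eq
  show "x + y + z = x + (y + z)" by (simp only: abs add.assoc)
  show "x + y = y + x" by (simp only: abs add.commute)
  show "0 + x = x" by (simp only: abs add_0)
  show "- x + x = 0" by (simp only: abs left_minus)
  show "x - y = x + - y" by (simp only: abs diff_conv_add_uminus)
  show "c *\<^sub>C (x + y) = c *\<^sub>C x + c *\<^sub>C y" by (simp only: abs scaleC_add_right)
  show "(c + d) *\<^sub>C x = c *\<^sub>C x + d *\<^sub>C x" by (simp only: abs scaleC_add_left)
  show "c *\<^sub>C d *\<^sub>C x = (c * d) *\<^sub>C x" by (simp only: abs scaleC_scaleC)
  show "1 *\<^sub>C x = x" by (simp only: abs scaleC_one)
  show "x * y * z = x * (y * z)" by (simp only: abs mult.assoc)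
  show "x * y = y * x" by (simp only: abs mult.commute)
  show "1 * x = x" by (simp only: abs mult_1)
  show "(x + y) * z = x * z + y * z" by (simp only: abs distrib_right)
  show "(c *\<^sub>C x) * y = c *\<^sub>C (x * y)" by (simp only: abs scaleC_mult_left)
  show "(0 :: ktilde) \<noteq> 1"
    by (simp add: zero_ktilde.abs_eq one_ktilde.abs_eq ktilde.abs_eq_iff k_ideal_1)
qed

end

lemma k_proj_algebra_hom: "algebra_hom k_proj"
  unfolding algebra_hom_def
  by (auto intro!: clinearI simp: plus_ktilde.abs_eq times_ktilde.abs_eq scaleC_ktilde.abs_eq
      one_ktilde.abs_eq)

lemma rep_ktilde_proj: "rep_ktilde (k_proj x) - x \<in> k_ideal"
  using Quotient3_rep_abs[OF Quotient3_ktilde, of x] k_ideal_0 by simp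

definition k_comult :: "ktilde \<Rightarrow> (ktilde, ktilde) tensor"
  where "k_comult x = tensor_map k_proj k_proj (gl_comult (rep_ktilde x))"

definition k_counit :: "ktilde \<Rightarrow> complex"
  where "k_counit x = gl_counit (rep_ktilde x)"

lemma k_proj_entry: "k_proj (gl_entry \<mu> 1) = (if \<mu> = 1 then 1 else 0)"
proof -
  have "k_proj (gl_entry \<mu> 1) = k_proj (if \<mu> = 1 then 1 else 0)"
    using exhaust_4[of \<mu>]
    by (auto simp: ktilde.abs_eq_iff k_ideal_def intro!: ideal.span_base)
  then show ?thesis by (auto simp: algebra_homD[OF k_proj_algebra_hom])
qed

lemma k_comult_proj: "k_comult (k_proj x) = tensor_map k_proj k_proj (gl_comult x)"
proof -
  note lin = algebra_homD(1)[OF k_proj_algebra_hom]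
  note pure = tensor_map_pure[OF lin lin]
  note hom = algebra_hom_tensor_map[OF k_proj_algebra_hom k_proj_algebra_hom]
  have hom': "algebra_hom (\<lambda>x. tensor_map k_proj k_proj (gl_comult x))"
    using algebra_homD[OF hom] algebra_homD[OF gl_comult_algebra_hom]
    by (auto simp: algebra_hom_def intro!: clinearI)
  have zero: "0 \<otimes> y = 0" "y \<otimes> 0 = 0" for y :: ktilde
    using pure_tensor_scaleC_left[of 0 0 y] pure_tensor_scaleC_right[of y 0 0] by simp_all
  have "tensor_map k_proj k_proj (gl_comult (gl_entry \<mu> 1)) = (if \<mu> = 1 then 1 else 0)" for \<mu>
    by (simp add: gl_comult_entry sum_4 algebra_homD[OF hom] pure k_proj_entry zero one_tensor_def)
  then show ?thesis
    unfolding k_comult_def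
    by (intro algebra_hom_ideal[OF hom' _ rep_ktilde_proj[unfolded k_ideal_def]])
      (auto simp: algebra_homD[OF hom'])
qed

lemma k_counit_proj: "k_counit (k_proj x) = gl_counit x"
  unfolding k_counit_def
  by (rule algebra_hom_ideal[OF gl_counit_algebra_hom _ rep_ktilde_proj[unfolded k_ideal_def]])
    (auto simp: algebra_homD[OF gl_counit_algebra_hom] gl_counit_entry)

text \<open>The polynomial algebra on \<open>t\<^bsup>A\<^esup>\<^bsub>A'\<^esub>\<close> is \<open>t_var mpol\<close>. Its generators pair with polynomials by
  differentiation followed by evaluation at zero.\<close>

typedef t_var = "{1, 2 :: 4} \<times> {3, 4 :: 4}"
  by blast

definition t_gen :: "4 \<Rightarrow> 4 \<Rightarrow> t_var mpol"
  where "t_gen A A' = mvar (Abs_t_var (A, A'))"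

definition t_deriv :: "4 \<Rightarrow> 4 \<Rightarrow> t_var mpol \<Rightarrow> t_var mpol"
  where "t_deriv A' A = mpol_deriv (Abs_t_var (A, A'))"

definition t_eval0 :: "t_var mpol \<Rightarrow> complex"
  where "t_eval0 = mpol_hom (\<lambda>_. 0)"

definition theta_operator ::
  "(4 \<Rightarrow> 4 \<Rightarrow> 4 \<Rightarrow> 4 \<Rightarrow> complex) \<Rightarrow> (t_var mpol, t_var mpol) tensor \<Rightarrow> (t_var mpol, t_var mpol) tensor"
  where "theta_operator \<theta> x = (\<Sum>A\<in>{1, 2}. \<Sum>B\<in>{1, 2}. \<Sum>A'\<in>{3, 4}. \<Sum>B'\<in>{3, 4}.
    (\<i> / 2 * \<theta> A B A' B') *\<^sub>C tensor_map (t_deriv A' A) (t_deriv B' B) x)"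

text \<open>The pairing of the exponential of \<open>theta_operator\<close> with \<open>h \<otimes> g\<close>; all but finitely many terms of
  the series vanish.\<close>

definition t_cocycle ::
  "(4 \<Rightarrow> 4 \<Rightarrow> 4 \<Rightarrow> 4 \<Rightarrow> complex) \<Rightarrow> t_var mpol \<Rightarrow> t_var mpol \<Rightarrow> complex"
  where "t_cocycle \<theta> h g = suminf (\<lambda>n. 1 / fact n *
    tensor_lift (\<lambda>p q. t_eval0 p * t_eval0 q) ((theta_operator \<theta> ^^ n) (h \<otimes> g)))"

definition gl_to_t :: "gl4 \<Rightarrow> t_var mpol"
  where "gl_to_t = gl_hom (\<chi> \<mu> \<nu>. if \<mu> \<in> {1, 2} \<and> \<nu> \<in> {3, 4} then t_gen \<mu> \<nu>
    else if \<mu> = \<nu> then 1 else 0)"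

definition k_to_t :: "ktilde \<Rightarrow> t_var mpol"
  where "k_to_t x = gl_to_t (rep_ktilde x)"

lemma gl_to_t_det:
  "det (\<chi> \<mu> \<nu>. if \<mu> \<in> {1, 2} \<and> \<nu> \<in> {3, 4} then - t_gen \<mu> \<nu> else if \<mu> = \<nu> then 1 else 0) *
    det (\<chi> \<mu> \<nu>. if \<mu> \<in> {1, 2} \<and> \<nu> \<in> {3, 4} then t_gen \<mu> \<nu> else if \<mu> = \<nu> then 1 else 0) = 1"
proof -
  have "(\<chi> \<mu> \<nu>. if \<mu> \<in> {1, 2} \<and> \<nu> \<in> {3, 4} then - t_gen \<mu> \<nu> else if \<mu> = \<nu> then 1 else 0) **
    (\<chi> \<mu> \<nu>. if \<mu> \<in> {1, 2} \<and> \<nu> \<in> {3, 4} then t_gen \<mu> \<nu> else if \<mu> = \<nu> then 1 else 0) = mat 1"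
    unfolding vec_eq_iff forall_4 matrix_matrix_mult_def by (simp add: sum_4 mat_def)
  then show ?thesis by (simp only: det_mul[symmetric] det_I)
qed

lemmas gl_to_t_algebra_hom = gl_hom_algebra_hom[OF gl_to_t_det, folded gl_to_t_def]

lemma gl_to_t_entry: "gl_to_t (gl_entry \<mu> \<nu>) =
    (if \<mu> \<in> {1, 2} \<and> \<nu> \<in> {3, 4} then t_gen \<mu> \<nu> else if \<mu> = \<nu> then 1 else 0)"
  unfolding gl_to_t_def by (subst gl_hom_entry[OF gl_to_t_det]) simp

lemma k_to_t_proj: "k_to_t (k_proj x) = gl_to_t x"
  unfolding k_to_t_def
  by (rule algebra_hom_ideal[OF gl_to_t_algebra_hom _ rep_ktilde_proj[unfolded k_ideal_def]])
    (auto simp: algebra_homD[OF gl_to_t_algebra_hom] gl_to_t_entry)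

text \<open>The vector space structure is that of the type; the product is a record field because the twist
  changes it. The antipode does not enter the twisted product and is omitted.\<close>

record (overloaded) ('h::complex_vector) bialgebra =
  bmult :: "'h \<Rightarrow> 'h \<Rightarrow> 'h"
  bunit :: 'h
  bcomult :: "'h \<Rightarrow> ('h, 'h) tensor"
  bcounit :: "'h \<Rightarrow> complex"

definition convolution ::
  "('h::complex_vector) bialgebra \<Rightarrow> ('h \<Rightarrow> 'h \<Rightarrow> complex) \<Rightarrow> ('h \<Rightarrow> 'h \<Rightarrow> complex) \<Rightarrow> 'h \<Rightarrow> 'h \<Rightarrow> complex"
  where "convolution H F G h g = tensor_lift (\<lambda>h1 h2. tensor_lift (\<lambda>g1 g2. F h1 g1 * G h2 g2)
    (bcomult H g)) (bcomult H h)"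

definition convolution_inverse ::
  "('h::complex_vector) bialgebra \<Rightarrow> ('h \<Rightarrow> 'h \<Rightarrow> complex) \<Rightarrow> 'h \<Rightarrow> 'h \<Rightarrow> complex"
  where "convolution_inverse H F = (THE G. cbilinear G \<and>
    convolution H F G = (\<lambda>h g. bcounit H h * bcounit H g) \<and>
    convolution H G F = (\<lambda>h g. bcounit H h * bcounit H g))"

definition bcomult3 :: "('h::complex_vector) bialgebra \<Rightarrow> 'h \<Rightarrow> ('h, ('h, 'h) tensor) tensor"
  where "bcomult3 H h = tensor_map id (bcomult H) (bcomult H h)"

definition tensor_lift3 ::
  "('a::complex_vector \<Rightarrow> 'b::complex_vector \<Rightarrow> 'c::complex_vector \<Rightarrow> 'd::complex_vector)
    \<Rightarrow> ('a, ('b, 'c) tensor) tensor \<Rightarrow> 'd"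
  where "tensor_lift3 f = tensor_lift (\<lambda>x. tensor_lift (f x))"

definition twist :: "('h::complex_vector) bialgebra \<Rightarrow> ('h \<Rightarrow> 'h \<Rightarrow> complex) \<Rightarrow> 'h bialgebra"
  where "twist H F = H\<lparr>bmult := \<lambda>h g.
    tensor_lift3 (\<lambda>h1 h2 h3. tensor_lift3 (\<lambda>g1 g2 g3.
        (F h1 g1 * convolution_inverse H F h3 g3) *\<^sub>C bmult H h2 g2)
      (bcomult3 H g)) (bcomult3 H h)\<rparr>"

definition comodule_twist ::
  "('h::complex_vector \<Rightarrow> 'h \<Rightarrow> complex) \<Rightarrow> ('a::complex_vector \<Rightarrow> ('h, 'a) tensor)
    \<Rightarrow> ('a \<Rightarrow> 'a \<Rightarrow> 'a) \<Rightarrow> 'a \<Rightarrow> 'a \<Rightarrow> 'a"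
  where "comodule_twist F \<delta> m a b = tensor_lift (\<lambda>a1 a2. tensor_lift (\<lambda>b1 b2.
    F a1 b1 *\<^sub>C m a2 b2) (\<delta> b)) (\<delta> a)"

definition right_coinvariants ::
  "('h::complex_vector) bialgebra \<Rightarrow> ('k::complex_vector) bialgebra \<Rightarrow> ('h \<Rightarrow> 'k) \<Rightarrow> 'h set"
  where "right_coinvariants H K p = {h. tensor_map id p (bcomult H h) = h \<otimes> bunit K}"

definition is_subalgebra :: "('h::complex_vector) bialgebra \<Rightarrow> 'h set \<Rightarrow> bool"
  where "is_subalgebra H S \<longleftrightarrow> complex_vector.subspace S \<and> bunit H \<in> S \<and>
    (\<forall>x\<in>S. \<forall>y\<in>S. bmult H x y \<in> S)"

definition GL4 :: "gl4 bialgebra"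
  where "GL4 = \<lparr>bmult = (*), bunit = 1, bcomult = gl_comult, bcounit = gl_counit\<rparr>"

definition Ktilde :: "ktilde bialgebra"
  where "Ktilde = \<lparr>bmult = (*), bunit = 1, bcomult = k_comult, bcounit = k_counit\<rparr>"

definition GL4_F :: "(4 \<Rightarrow> 4 \<Rightarrow> 4 \<Rightarrow> 4 \<Rightarrow> complex) \<Rightarrow> gl4 bialgebra"
  where "GL4_F \<theta> = twist GL4 (\<lambda>h g. t_cocycle \<theta> (gl_to_t h) (gl_to_t g))"

definition Ktilde_F :: "(4 \<Rightarrow> 4 \<Rightarrow> 4 \<Rightarrow> 4 \<Rightarrow> complex) \<Rightarrow> ktilde bialgebra"
  where "Ktilde_F \<theta> = twist Ktilde (\<lambda>h g. t_cocycle \<theta> (k_to_t h) (k_to_t g))"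

definition Z :: "4 \<Rightarrow> 4 mpol"
  where "Z = mvar"

definition T_coaction :: "4 mpol \<Rightarrow> (gl4, 4 mpol) tensor"
  where "T_coaction = mpol_hom (\<lambda>\<mu>. \<Sum>\<alpha>\<in>UNIV. gl_entry \<mu> \<alpha> \<otimes> Z \<alpha>)"

definition T_mult :: "(4 \<Rightarrow> 4 \<Rightarrow> 4 \<Rightarrow> 4 \<Rightarrow> complex) \<Rightarrow> 4 mpol \<Rightarrow> 4 mpol \<Rightarrow> 4 mpol"
  where "T_mult \<theta> = comodule_twist (\<lambda>h g. t_cocycle \<theta> (gl_to_t h) (gl_to_t g)) T_coaction (*)"

definition theta_ext :: "(4 \<Rightarrow> 4 \<Rightarrow> 4 \<Rightarrow> 4 \<Rightarrow> complex) \<Rightarrow> 4 \<Rightarrow> 4 \<Rightarrow> 4 \<Rightarrow> 4 \<Rightarrow> complex"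
  where "theta_ext \<theta> \<mu> \<alpha> \<nu> \<beta> =
    (if \<mu> \<in> {1, 2} \<and> \<alpha> \<in> {1, 2} \<and> \<nu> \<in> {3, 4} \<and> \<beta> \<in> {3, 4} then \<theta> \<mu> \<alpha> \<nu> \<beta> else 0)"

end

theory Submission
  imports Defs
begin

text \<open>Write \<open>x\<close> for the first column of the generic matrix, let \<open>\<phi>\<close> send \<open>Z \<mu>\<close> to its entry \<open>x \<mu>\<close>, and let
  \<open>p\<close> be the map to the translation coordinates. Then \<open>\<phi>\<close> is a comodule map, and \<open>h\<^sub>1 \<otimes> p(h\<^sub>2) = h \<otimes> 1\<close> for \<open>h\<close> in
  the image of \<open>\<phi>\<close>. In \<open>h \<bullet> g = F(h\<^sub>1, g\<^sub>1) h\<^sub>2 g\<^sub>2 F\<^sup>-\<^sup>1(h\<^sub>3, g\<^sub>3)\<close>, where \<open>F\<close> factors through \<open>p\<close>, the last factor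
  therefore drops out for such \<open>h\<close>, \<open>g\<close>, and what remains is the image of the product of the comodule twist.

  The inverse of the cocycle is the cocycle for \<open>-\<theta>\<close>: the derivatives are translation invariant, so that the
  \<open>n\<close>-th and the \<open>m\<close>-th term of the exponential series convolve to the term of order \<open>n + m\<close>, and the locally
  finite series multiply as exponentials do.

  A coinvariant takes the same value at matrices with the same first column. Evaluating it at a matrix
  that completes \<open>x\<close> by unit vectors and has determinant \<open>\<plusminus>x i\<close> presents it as a polynomial in \<open>x\<close> divided by
  a power of \<open>x i\<close>, for \<open>i = 1\<close> and for \<open>i = 2\<close>; hence it is a polynomial in \<open>x\<close>.\<close>

section \<open>Tensor calculus\<close>

lemma clinear_ident: "clinear (\<lambda>x. x)"
  by (simp add: clinearI)

lemma clinear_id: "clinear id"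
  by (simp add: clinearI)

lemma clinear_compose: "clinear f \<Longrightarrow> clinear g \<Longrightarrow> clinear (\<lambda>x. f (g x))"
  by (rule clinearI) (simp_all add: clinear_add clinear_scale)

lemma clinear_scaleC_const: "clinear f \<Longrightarrow> clinear (\<lambda>x. c *\<^sub>C f x)"
  by (rule clinearI) (simp_all add: clinear_add clinear_scale scaleC_add_right scaleC_scaleC mult.commute)

lemma clinear_scaleC_left: "clinear f \<Longrightarrow> clinear (\<lambda>x. f x *\<^sub>C v)"
  by (rule clinearI)
    (simp_all add: clinear_add clinear_scale scaleC_add_left scaleC_scaleC scaleC_complex_def)

lemma clinear_plus: "clinear f \<Longrightarrow> clinear g \<Longrightarrow> clinear (\<lambda>x. f x + g x)"
  by (rule clinearI) (simp_all add: clinear_add clinear_scale scaleC_add_right)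

lemma clinear_setsum: "(\<And>i. i \<in> I \<Longrightarrow> clinear (f i)) \<Longrightarrow> clinear (\<lambda>x. \<Sum>i\<in>I. f i x)"
  by (rule clinearI) (simp_all add: clinear_add clinear_scale sum.distrib complex_vector.scale_sum_right)

lemma clinear_mult_left: "clinear f \<Longrightarrow> clinear (\<lambda>x. f x * c)" for c :: "'a::complex_comm_algebra"
  by (rule clinear_compose[OF clinear_mult(2)])

lemma clinear_mult_right: "clinear f \<Longrightarrow> clinear (\<lambda>x. c * f x)" for c :: "'a::complex_comm_algebra"
  by (rule clinear_compose[OF clinear_mult(1)])

lemma cbilinear_iff: "cbilinear f \<longleftrightarrow> (\<forall>x. clinear (\<lambda>y. f x y)) \<and> (\<forall>y. clinear (\<lambda>x. f x y))"
  by (simp add: cbilinear_def)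

lemma cbilinear_intro:
  "(\<And>x. clinear (\<lambda>y. f x y)) \<Longrightarrow> (\<And>y. clinear (\<lambda>x. f x y)) \<Longrightarrow> cbilinear f"
  by (simp add: cbilinear_iff)

lemma clinear_cbilinear1: "cbilinear f \<Longrightarrow> clinear g \<Longrightarrow> clinear (\<lambda>x. f (g x) y)"
  by (rule clinear_compose[of "\<lambda>x. f x y"]) (simp_all add: cbilinear_iff)

lemma clinear_cbilinear2: "cbilinear f \<Longrightarrow> clinear g \<Longrightarrow> clinear (\<lambda>x. f y (g x))"
  by (rule clinear_compose[of "f y"]) (simp_all add: cbilinear_iff)

lemmas clinear_pure1 = clinear_cbilinear1[OF cbilinear_pure_tensor]
lemmas clinear_pure2 = clinear_cbilinear2[OF cbilinear_pure_tensor]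

text \<open>As \<open>tensor_lift\<close> is a finite sum over a chosen representative, the following identities need
  no bilinearity.\<close>

lemma tensor_lift_swap:
  "tensor_lift (\<lambda>x y. tensor_lift (\<lambda>u v. f x y u v) t) s
    = tensor_lift (\<lambda>u v. tensor_lift (\<lambda>x y. f x y u v) s) t"
  unfolding tensor_lift_def linear_ext_def
  by (simp add: case_prod_beta complex_vector.scale_sum_right scaleC_scaleC mult.commute)
    (rule sum.swap)

lemma clinear_of_tensor_lift:
  "clinear L \<Longrightarrow> L (tensor_lift f t) = tensor_lift (\<lambda>x y. L (f x y)) t"
  unfolding tensor_lift_def linear_ext_def
  by (simp add: clinear_sum clinear_scale case_prod_beta)

lemma tensor_lift_sum:
  "tensor_lift (\<lambda>x y. \<Sum>i\<in>I. f i x y) t = (\<Sum>i\<in>I. tensor_lift (f i) t)"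
  unfolding tensor_lift_def linear_ext_def
  by (simp add: case_prod_beta complex_vector.scale_sum_right) (rule sum.swap)

lemma tensor_lift_mult_left: "tensor_lift (\<lambda>x y. c * f x y) t = c * tensor_lift f t"
  for c :: "'a::complex_comm_algebra"
  by (rule clinear_of_tensor_lift[symmetric]) (intro clinear_mult)

lemma tensor_lift_mult_right: "tensor_lift (\<lambda>x y. f x y * c) t = tensor_lift f t * c"
  for c :: "'a::complex_comm_algebra"
  by (rule clinear_of_tensor_lift[symmetric]) (intro clinear_mult)

lemma clinear_tensor_lift_fun:
  assumes "\<And>x y. clinear (\<lambda>z. f z x y)"
  shows "clinear (\<lambda>z. tensor_lift (f z) t)"
  unfolding tensor_lift_def linear_ext_def case_prod_beta
  by (intro clinear_setsum clinear_scaleC_const assms)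

lemma clinear_tensor_lift_arg: "cbilinear f \<Longrightarrow> clinear g \<Longrightarrow> clinear (\<lambda>z. tensor_lift f (g z))"
  by (rule clinear_compose[OF tensor_lift_clinear])

text \<open>Structural rules that reduce linearity of a nested Sweedler-type expression to linearity
  of its constituents.\<close>

lemmas clinear_intros = clinear_ident clinear_id clinear_scaleC_const clinear_scaleC_left clinear_plus
  clinear_setsum clinear_mult_left clinear_mult_right clinear_pure1 clinear_pure2
  clinear_tensor_lift_fun clinear_tensor_lift_arg cbilinear_intro

lemma clinear_eq_on_tensor:
  assumes "clinear f" "clinear g" "\<And>x y. f (x \<otimes> y) = g (x \<otimes> y)"
  shows "f t = g t"
  by (induction t rule: tensor_induct) (simp_all add: assms clinear_add)

lemma tensor_lift_tensor_map:
  assumes "cbilinear f" "clinear a" "clinear b"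
  shows "tensor_lift f (tensor_map a b t) = tensor_lift (\<lambda>x y. f (a x) (b y)) t"
proof (rule clinear_eq_on_tensor)
  show "clinear (\<lambda>t. tensor_lift f (tensor_map a b t))"
    by (rule clinear_tensor_lift_arg[OF assms(1) tensor_map_clinear[OF assms(2,3)]])
  show "clinear (tensor_lift (\<lambda>x y. f (a x) (b y)))"
    by (rule tensor_lift_clinear[OF cbilinear_comp[OF assms]])
  show "tensor_lift f (tensor_map a b (x \<otimes> y)) = tensor_lift (\<lambda>x y. f (a x) (b y)) (x \<otimes> y)" for x y
    by (simp add: assms tensor_map_pure cbilinear_comp)
qed

definition ctrilinear ::
  "('a::complex_vector \<Rightarrow> 'b::complex_vector \<Rightarrow> 'c::complex_vector \<Rightarrow> 'd::complex_vector) \<Rightarrow> bool"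
  where "ctrilinear f \<longleftrightarrow> (\<forall>x. cbilinear (f x)) \<and> (\<forall>y z. clinear (\<lambda>x. f x y z))"

lemma ctrilinear_intro:
  "(\<And>x y. clinear (\<lambda>z. f x y z)) \<Longrightarrow> (\<And>x z. clinear (\<lambda>y. f x y z)) \<Longrightarrow> (\<And>y z. clinear (\<lambda>x. f x y z))
    \<Longrightarrow> ctrilinear f"
  by (simp add: ctrilinear_def cbilinear_iff)

lemma ctrilinear_lift:
  assumes "ctrilinear f"
  shows "cbilinear (\<lambda>x. tensor_lift (f x))"
  using assms unfolding ctrilinear_def
  by (intro cbilinear_intro clinear_tensor_lift_fun tensor_lift_clinear) (auto simp: cbilinear_iff)

lemma tensor_lift3_clinear: "ctrilinear f \<Longrightarrow> clinear (tensor_lift3 f)"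
  unfolding tensor_lift3_def by (intro tensor_lift_clinear ctrilinear_lift)

lemma tensor_lift3_pure: "ctrilinear f \<Longrightarrow> tensor_lift3 f (x \<otimes> y \<otimes> z) = f x y z"
  unfolding tensor_lift3_def by (simp add: ctrilinear_lift) (simp add: ctrilinear_def)

text \<open>The argument has the shape of \<open>bcomult3\<close>, so a trilinear expression in an
  iterated coproduct becomes two nested lifts.\<close>

lemma tensor_lift3_map:
  assumes "ctrilinear f" "clinear \<Delta>"
  shows "tensor_lift3 f (tensor_map id \<Delta> t) = tensor_lift (\<lambda>x y. tensor_lift (f x) (\<Delta> y)) t"
  unfolding tensor_lift3_def
  by (simp add: tensor_lift_tensor_map ctrilinear_lift assms clinear_id)

section \<open>Convolution of bilinear forms\<close>

text \<open>Both iterated coproducts are written in the same right-nested triple tensor product, so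
  that coassociativity is an equation of elements without an associator.\<close>

locale coassociative_counital =
  fixes H :: "('h::complex_vector) bialgebra"
  assumes comult_clinear: "clinear (bcomult H)" and counit_clinear: "clinear (bcounit H)"
    and coassoc_pure:
      "tensor_lift (\<lambda>x z. tensor_lift (\<lambda>x' y. x' \<otimes> y \<otimes> z) (bcomult H x)) (bcomult H h)
        = tensor_lift (\<lambda>x z. tensor_lift (\<lambda>y z'. x \<otimes> y \<otimes> z') (bcomult H z)) (bcomult H h)"
    and counit_left_pure: "tensor_lift (\<lambda>x y. bcounit H x *\<^sub>C y) (bcomult H h) = h"
    and counit_right_pure: "tensor_lift (\<lambda>x y. bcounit H y *\<^sub>C x) (bcomult H h) = h"
begin

abbreviation convolution_unit :: "'h \<Rightarrow> 'h \<Rightarrow> complex"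
  where "convolution_unit \<equiv> \<lambda>h g. bcounit H h * bcounit H g"

text \<open>A trilinear map factors linearly through the triple tensor product, and this linear map
  is applied to both sides of \<open>coassoc_pure\<close>.\<close>

lemma coassoc:
  assumes "ctrilinear f"
  shows "tensor_lift (\<lambda>x z. tensor_lift (\<lambda>x' y. f x' y z) (bcomult H x)) (bcomult H h)
        = tensor_lift (\<lambda>x z. tensor_lift (\<lambda>y z'. f x y z') (bcomult H z)) (bcomult H h)"
  using arg_cong[OF coassoc_pure, of "tensor_lift3 f" h]
  by (simp add: clinear_of_tensor_lift[OF tensor_lift3_clinear[OF assms]] tensor_lift3_pure[OF assms])

lemma counit_left:
  assumes "clinear f"
  shows "tensor_lift (\<lambda>x y. bcounit H x *\<^sub>C f y) (bcomult H h) = f h"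
  using arg_cong[OF counit_left_pure, of f h]
  by (simp add: clinear_of_tensor_lift[OF assms] clinear_scale[OF assms])

lemma counit_right:
  assumes "clinear f"
  shows "tensor_lift (\<lambda>x y. bcounit H y *\<^sub>C f x) (bcomult H h) = f h"
  using arg_cong[OF counit_right_pure, of f h]
  by (simp add: clinear_of_tensor_lift[OF assms] clinear_scale[OF assms])

lemma convolution_unit_left:
  assumes "cbilinear F"
  shows "convolution H convolution_unit F = F"
proof (intro ext)
  fix h g
  have "convolution H convolution_unit F h g = tensor_lift (\<lambda>x y. bcounit H x *\<^sub>C
      tensor_lift (\<lambda>u v. bcounit H u *\<^sub>C F y v) (bcomult H g)) (bcomult H h)"
    by (simp add: convolution_def scaleC_complex_def mult.assoc tensor_lift_mult_left)
  also have "\<dots> = F h g"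
    using assms by (simp add: counit_left cbilinear_iff)
  finally show "convolution H convolution_unit F h g = F h g" .
qed

lemma convolution_unit_right:
  assumes "cbilinear F"
  shows "convolution H F convolution_unit = F"
proof (intro ext)
  fix h g
  have "convolution H F convolution_unit h g = tensor_lift (\<lambda>x y. bcounit H y *\<^sub>C
      tensor_lift (\<lambda>u v. bcounit H v *\<^sub>C F x u) (bcomult H g)) (bcomult H h)"
    by (simp add: convolution_def scaleC_complex_def mult.commute mult.left_commute
        flip: tensor_lift_mult_left)
  also have "\<dots> = F h g"
    using assms by (simp add: counit_right cbilinear_iff)
  finally show "convolution H F convolution_unit h g = F h g" .
qed

text \<open>Coassociativity enters once for each argument, first for \<open>g\<close> and then for
  \<open>h\<close>. The interchanges before and after it bring the two lifts that split the same
  argument next to each other.\<close>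

lemma convolution_assoc:
  assumes F: "cbilinear F" and G: "cbilinear G" and K: "cbilinear K"
  shows "convolution H (convolution H F G) K = convolution H F (convolution H G K)"
proof (intro ext)
  fix h g
  note lin = F[THEN clinear_cbilinear1] F[THEN clinear_cbilinear2] G[THEN clinear_cbilinear1]
    G[THEN clinear_cbilinear2] K[THEN clinear_cbilinear1] K[THEN clinear_cbilinear2]
  let ?\<Delta> = "bcomult H"
  have "convolution H (convolution H F G) K h g =
    tensor_lift (\<lambda>x y. tensor_lift (\<lambda>u v. tensor_lift (\<lambda>x1 x2. tensor_lift (\<lambda>u1 u2.
      F x1 u1 * G x2 u2 * K y v) (?\<Delta> u)) (?\<Delta> x)) (?\<Delta> g)) (?\<Delta> h)"
    by (simp add: convolution_def tensor_lift_mult_right)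
  also have "\<dots> = tensor_lift (\<lambda>x y. tensor_lift (\<lambda>x1 x2. tensor_lift (\<lambda>u v. tensor_lift (\<lambda>u1 u2.
      F x1 u1 * G x2 u2 * K y v) (?\<Delta> u)) (?\<Delta> g)) (?\<Delta> x)) (?\<Delta> h)"
    by (subst tensor_lift_swap[where s = "?\<Delta> g"]) (rule refl)
  also have "\<dots> = tensor_lift (\<lambda>x y. tensor_lift (\<lambda>x1 x2. tensor_lift (\<lambda>u v. tensor_lift (\<lambda>v1 v2.
      F x1 u * G x2 v1 * K y v2) (?\<Delta> v)) (?\<Delta> g)) (?\<Delta> x)) (?\<Delta> h)"
    by (subst coassoc, intro ctrilinear_intro clinear_intros lin) (rule refl)
  also have "\<dots> = tensor_lift (\<lambda>x y. tensor_lift (\<lambda>y1 y2. tensor_lift (\<lambda>u v. tensor_lift (\<lambda>v1 v2.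
      F x u * G y1 v1 * K y2 v2) (?\<Delta> v)) (?\<Delta> g)) (?\<Delta> y)) (?\<Delta> h)"
    by (rule coassoc, intro ctrilinear_intro clinear_intros lin)
  also have "\<dots> = tensor_lift (\<lambda>x y. tensor_lift (\<lambda>u v. tensor_lift (\<lambda>y1 y2. tensor_lift (\<lambda>v1 v2.
      F x u * (G y1 v1 * K y2 v2)) (?\<Delta> v)) (?\<Delta> y)) (?\<Delta> g)) (?\<Delta> h)"
    by (subst tensor_lift_swap[where s = "?\<Delta> g"]) (simp add: mult.assoc)
  also have "\<dots> = convolution H F (convolution H G K) h g"
    by (simp add: convolution_def tensor_lift_mult_left)
  finally show "convolution H (convolution H F G) K h g = convolution H F (convolution H G K) h g" .
qed

text \<open>Associativity and the unit laws make two-sided inverses unique, so the definite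
  description in \<open>convolution_inverse\<close> denotes \<open>G\<close>.\<close>

lemma convolution_inverse_eq:
  assumes "cbilinear F" "cbilinear G"
    and "convolution H F G = convolution_unit" "convolution H G F = convolution_unit"
  shows "convolution_inverse H F = G"
  unfolding convolution_inverse_def
proof (rule the_equality)
  show "cbilinear G \<and> convolution H F G = convolution_unit \<and> convolution H G F = convolution_unit"
    using assms by simp
  show "G' = G" if "cbilinear G' \<and> convolution H F G' = convolution_unit
      \<and> convolution H G' F = convolution_unit" for G'
    using that assms convolution_assoc convolution_unit_left convolution_unit_right by metis
qed

end

section \<open>Polynomials\<close>

lemma poly_mapping_sum_single:
  "p = (\<Sum>k\<in>Poly_Mapping.keys p. Poly_Mapping.single k (Poly_Mapping.lookup p k))"
proof (rule poly_mapping_eqI)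
  fix k
  have "(\<Sum>j\<in>Poly_Mapping.keys p. Poly_Mapping.lookup p j when j = k)
      = (\<Sum>j\<in>Poly_Mapping.keys p. if k = j then Poly_Mapping.lookup p j else 0)"
    by (intro sum.cong) (auto simp: when_def)
  also have "\<dots> = Poly_Mapping.lookup p k"
    by (subst sum.delta'[OF finite_keys]) (simp add: in_keys_iff)
  finally show "Poly_Mapping.lookup p k
      = Poly_Mapping.lookup (\<Sum>k\<in>Poly_Mapping.keys p. Poly_Mapping.single k (Poly_Mapping.lookup p k)) k"
    by (simp only: lookup_sum lookup_single)
qed

lemma mvar_power: "mvar v ^ n = Poly_Mapping.single (Poly_Mapping.single v n) 1"
  by (induction n) (simp_all add: mvar_def mult_single flip: single_add)

text \<open>Every monomial is a product of powers of variables. The rule suits claims that are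
  stable under the algebra operations, such as identities between homomorphisms or
  derivations.\<close>

lemma mpol_induct [case_names var one scale add mult]:
  fixes p :: "'v mpol"
  assumes var: "\<And>v. P (mvar v)" and one: "P 1"
    and scale: "\<And>c p. P p \<Longrightarrow> P (c *\<^sub>C p)" and add: "\<And>p q. P p \<Longrightarrow> P q \<Longrightarrow> P (p + q)"
    and mult: "\<And>p q. P p \<Longrightarrow> P q \<Longrightarrow> P (p * q)"
  shows "P p"
proof (induction p rule: poly_mapping_linear_induct)
  case (1 k c)
  have power: "P (mvar v ^ n)" for v n
    by (induction n) (auto intro: one var mult)
  have "P (Poly_Mapping.single (\<Sum>v\<in>S. Poly_Mapping.single v (Poly_Mapping.lookup k v)) 1)"
    if "finite S" for S
    using that
  proof induction
    case empty
    then show ?case using one by simp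
  next
    case (insert v S)
    then show ?case
      using mult[OF power[of v "Poly_Mapping.lookup k v"] insert.IH]
      by (simp add: mvar_power mult_single)
  qed
  then have "P (Poly_Mapping.single k 1)"
    by (subst poly_mapping_sum_single) simp
  then have "P (c *\<^sub>C Poly_Mapping.single k 1)"
    by (rule scale)
  then show ?case
    by (simp add: scaleC_single scaleC_complex_def)
qed (rule add)

lemma algebra_hom_mpol_ext:
  assumes "algebra_hom f" "algebra_hom g" "\<And>v. f (mvar v) = g (mvar v)"
  shows "f p = g p"
  by (induction p rule: mpol_induct)
    (simp_all add: assms algebra_homD[OF assms(1)] algebra_homD[OF assms(2)])

lemma algebra_hom_compose:
  "algebra_hom f \<Longrightarrow> algebra_hom g \<Longrightarrow> algebra_hom (\<lambda>x. f (g x))"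
  by (auto simp: algebra_hom_def intro: clinear_compose)

lemma algebra_hom_unit: "algebra_hom (\<lambda>c. c *\<^sub>C 1)"
  by (auto simp: algebra_hom_def scaleC_one scaleC_mult_left scaleC_scaleC clinear_scaleC_left clinear_ident
      intro: clinear_intros)

lemma algebra_hom_id: "algebra_hom id"
  by (simp add: algebra_hom_def clinear_id)

lemma algebra_hom_pure_left: "algebra_hom (\<lambda>x. x \<otimes> 1)"
  and algebra_hom_pure_right: "algebra_hom (\<lambda>x. 1 \<otimes> x)"
  by (auto simp: algebra_hom_def one_tensor_def tensor_times_pure intro: clinear_intros)

lemma algebra_hom_sum: "algebra_hom f \<Longrightarrow> f (\<Sum>i\<in>I. g i) = (\<Sum>i\<in>I. f (g i))"
  by (rule clinear_sum[OF algebra_homD(1)])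

lemma algebra_hom_power: "algebra_hom f \<Longrightarrow> f (x ^ n) = f x ^ n"
  by (induction n) (simp_all add: algebra_homD)

text \<open>Multiplicativity rests on commutativity of the target, where the values of
  \<open>f\<close> and \<open>g\<close> can be reordered.\<close>

lemma algebra_hom_tensor_lift:
  assumes "algebra_hom f" "algebra_hom g"
  shows "algebra_hom (tensor_lift (\<lambda>x y. f x * g y))"
proof -
  note lins = assms[THEN algebra_homD(1)]
  have bil: "cbilinear (\<lambda>x y. f x * g y)"
    by (intro clinear_intros lins)
  note lin = tensor_lift_clinear[OF bil]
  have "tensor_lift (\<lambda>x y. f x * g y) (s * t)
    = tensor_lift (\<lambda>x y. f x * g y) s * tensor_lift (\<lambda>x y. f x * g y) t" for s t
  proof (induction s rule: tensor_induct)
    case (pure a b)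
    show ?case
      by (induction t rule: tensor_induct)
        (simp_all add: tensor_times_pure bil assms algebra_homD mult_ac distrib_left clinear_add[OF lin])
  qed (simp add: distrib_right clinear_add[OF lin])
  then show ?thesis
    using lin by (simp add: algebra_hom_def one_tensor_def bil assms[THEN algebra_homD(2)])
qed

section \<open>Partial derivatives and the additive coproduct\<close>

lemma mpol_deriv_clinear: "clinear (mpol_deriv v)"
  unfolding mpol_deriv_def by (rule linear_ext_clinear)

lemma mpol_deriv_single: "mpol_deriv v (Poly_Mapping.single m c) =
    Poly_Mapping.single (m - Poly_Mapping.single v 1) (c * of_nat (Poly_Mapping.lookup m v))"
  by (simp add: mpol_deriv_def scaleC_single scaleC_complex_def)

lemma mpol_deriv_mvar: "mpol_deriv v (mvar w) = (if w = v then 1 else 0)"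
  by (auto simp: mvar_def mpol_deriv_single lookup_single)

lemma mpol_deriv_one: "mpol_deriv v 1 = 0"
  using mpol_deriv_single[of v 0 1] by simp

lemma mpol_deriv_mult: "mpol_deriv v (p * q) = mpol_deriv v p * q + p * mpol_deriv v q"
proof -
  note add = clinear_add[OF mpol_deriv_clinear]
  \<comment> \<open>Subtraction of exponents is truncated. If \<open>v\<close> does not occur in
    \<open>m\<close>, the coefficient on both sides is zero; otherwise the subtraction is exact and
    commutes with adding \<open>n\<close>.\<close>
  have mono: "Poly_Mapping.single (m - Poly_Mapping.single v 1 + n) (c * of_nat (Poly_Mapping.lookup m v))
    = Poly_Mapping.single (m + n - Poly_Mapping.single v 1) (c * of_nat (Poly_Mapping.lookup m v))"
    for m n and c :: complex
  proof (cases "Poly_Mapping.lookup m v = 0")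
    case False
    then have "m - Poly_Mapping.single v 1 + n = m + n - Poly_Mapping.single v 1"
      by (intro poly_mapping_eqI) (auto simp: lookup_add lookup_minus lookup_single when_def)
    then show ?thesis by simp
  qed simp
  show ?thesis
  proof (induction p rule: poly_mapping_linear_induct)
    case (1 m c)
    show ?case
    proof (induction q rule: poly_mapping_linear_induct)
      case (1 n d)
      have "Poly_Mapping.single (m + (n - Poly_Mapping.single v 1)) (c * d * of_nat (Poly_Mapping.lookup n v))
        = Poly_Mapping.single (m + n - Poly_Mapping.single v 1) (c * d * of_nat (Poly_Mapping.lookup n v))"
        using mono[of n m "c * d"] by (simp add: add.commute)
      moreover have "Poly_Mapping.single (m - Poly_Mapping.single v 1 + n) (c * d * of_nat (Poly_Mapping.lookup m v))
        = Poly_Mapping.single (m + n - Poly_Mapping.single v 1) (c * d * of_nat (Poly_Mapping.lookup m v))"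
        by (rule mono)
      ultimately show ?case
        unfolding mult_single mpol_deriv_single lookup_add of_nat_add distrib_left single_add
        by (simp only: mult.assoc mult.commute mult.left_commute add.commute)
    qed (simp add: distrib_left add algebra_simps)
  qed (simp add: distrib_right add algebra_simps)
qed

text \<open>All variables are primitive: in terms of functions, p is sent to p(x + y) in two sets of
  variables.\<close>

definition mpol_comult :: "'v mpol \<Rightarrow> ('v mpol, 'v mpol) tensor"
  where "mpol_comult = mpol_hom (\<lambda>v. mvar v \<otimes> 1 + 1 \<otimes> mvar v)"

lemmas mpol_comult_algebra_hom =
  mpol_hom_algebra_hom[of "\<lambda>v. mvar v \<otimes> 1 + 1 \<otimes> mvar v", folded mpol_comult_def]

lemma mpol_comult_mvar: "mpol_comult (mvar v) = mvar v \<otimes> 1 + 1 \<otimes> mvar v"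
  by (simp add: mpol_comult_def)

lemma pure_tensor_zero: "0 \<otimes> y = 0" "y \<otimes> 0 = 0"
  using pure_tensor_scaleC_left[of 0 0 y] pure_tensor_scaleC_right[of y 0 0] by simp_all

lemma tensor_map_deriv_mult:
  "tensor_map (mpol_deriv v) (\<lambda>x. x) (s * t)
    = tensor_map (mpol_deriv v) (\<lambda>x. x) s * t + s * tensor_map (mpol_deriv v) (\<lambda>x. x) t"
proof -
  note lin = clinear_add[OF tensor_map_clinear[OF mpol_deriv_clinear clinear_ident]]
  show ?thesis
  proof (induction s rule: tensor_induct)
    case (pure a b)
    show ?case
      by (induction t rule: tensor_induct)
        (simp_all add: tensor_times_pure tensor_map_pure mpol_deriv_clinear clinear_ident mpol_deriv_mult
          pure_tensor_add_left lin algebra_simps)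
  qed (simp add: lin algebra_simps)
qed

text \<open>Translation invariance of the derivative: differentiating p(x + y) in x gives the
  derivative of p at x + y. Both sides obey the same product rule, so the variables decide.\<close>

lemma mpol_comult_deriv:
  "tensor_map (mpol_deriv v) (\<lambda>x. x) (mpol_comult p) = mpol_comult (mpol_deriv v p)"
proof -
  note lin = tensor_map_clinear[OF mpol_deriv_clinear clinear_ident]
  note pure = tensor_map_pure[OF mpol_deriv_clinear clinear_ident]
  note hom = algebra_homD[OF mpol_comult_algebra_hom]
  show ?thesis
  proof (induction p rule: mpol_induct)
    case (var w)
    then show ?case
      by (simp add: mpol_comult_mvar clinear_add[OF lin] pure mpol_deriv_mvar mpol_deriv_one hom
          pure_tensor_zero one_tensor_def)
  next
    case one
    then show ?case
      by (simp add: hom mpol_deriv_one one_tensor_def pure pure_tensor_zero)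
  next
    case (scale c p)
    then show ?case
      by (simp add: hom clinear_scale[OF lin] clinear_scale[OF mpol_deriv_clinear])
  next
    case (add p q)
    then show ?case
      by (simp add: hom clinear_add[OF lin] clinear_add[OF mpol_deriv_clinear])
  next
    case (mult p q)
    then show ?case
      by (simp add: hom tensor_map_deriv_mult mpol_deriv_mult)
  qed
qed

text \<open>This is p(x + y) at x = 0.\<close>

lemma mpol_comult_counit:
  assumes "clinear f"
  shows "tensor_lift (\<lambda>x y. mpol_hom (\<lambda>_. 0) x *\<^sub>C f y) (mpol_comult p) = f p"
proof -
  \<comment> \<open>Composed with the unit, evaluation at zero becomes a homomorphism into the
    polynomials, so the identity can be checked on variables.\<close>
  have hom: "algebra_hom (\<lambda>x :: 'a mpol. mpol_hom (\<lambda>_. 0) x *\<^sub>C (1 :: 'a mpol))"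
    by (rule algebra_hom_compose[OF algebra_hom_unit mpol_hom_algebra_hom])
  note hom' = algebra_hom_tensor_lift[OF hom algebra_hom_id]
  have bil: "cbilinear (\<lambda>x y :: 'a mpol. (mpol_hom (\<lambda>_. 0) x *\<^sub>C 1) * y)"
    by (intro clinear_intros algebra_homD(1)[OF mpol_hom_algebra_hom])
  have "tensor_lift (\<lambda>x y. (mpol_hom (\<lambda>_. 0) x *\<^sub>C 1) * id y) (mpol_comult p) = id p"
    by (rule algebra_hom_mpol_ext[OF algebra_hom_compose[OF hom' mpol_comult_algebra_hom] algebra_hom_id])
      (simp add: mpol_comult_mvar algebra_homD[OF mpol_hom_algebra_hom] scaleC_one bil
        clinear_add[OF tensor_lift_clinear[OF bil]])
  then have "tensor_lift (\<lambda>x y. mpol_hom (\<lambda>_. 0) x *\<^sub>C y) (mpol_comult p) = p"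
    by (simp add: scaleC_mult_left)
  from arg_cong[OF this, of f] show ?thesis
    by (simp add: clinear_of_tensor_lift[OF assms] clinear_scale[OF assms])
qed

section \<open>The cocycle on the translation coordinates\<close>

text \<open>The factor \<open>1 / fact n\<close> is left out, so that terms of orders
  \<open>n\<close> and \<open>m\<close> convolve to the term of order \<open>n + m\<close> without a
  binomial coefficient.\<close>

definition cocycle_term :: "(4 \<Rightarrow> 4 \<Rightarrow> 4 \<Rightarrow> 4 \<Rightarrow> complex) \<Rightarrow> nat \<Rightarrow> t_var mpol \<Rightarrow> t_var mpol \<Rightarrow> complex"
  where "cocycle_term \<theta> n p q =
    tensor_lift (\<lambda>p q. t_eval0 p * t_eval0 q) ((theta_operator \<theta> ^^ n) (p \<otimes> q))"

lemma t_cocycle_eq: "t_cocycle \<theta> p q = suminf (\<lambda>n. 1 / fact n * cocycle_term \<theta> n p q)"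
  by (simp add: t_cocycle_def cocycle_term_def)

lemma t_eval0_algebra_hom: "algebra_hom t_eval0"
  unfolding t_eval0_def by (rule mpol_hom_algebra_hom)

lemma t_eval0_mult_bilinear: "cbilinear (\<lambda>p q. t_eval0 p * t_eval0 q)"
  by (intro clinear_intros algebra_homD(1)[OF t_eval0_algebra_hom])

lemma t_deriv_clinear: "clinear (t_deriv A' A)"
  unfolding t_deriv_def by (rule mpol_deriv_clinear)

lemma theta_operator_clinear: "clinear (theta_operator \<theta>)"
  unfolding theta_operator_def
  by (intro clinear_intros tensor_map_clinear t_deriv_clinear)

lemma theta_operator_funpow_clinear: "clinear (theta_operator \<theta> ^^ n)"
proof (induction n)
  case (Suc n)
  then show ?case
    using clinear_compose[OF theta_operator_clinear Suc] by (simp add: comp_def)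
qed (simp add: id_def[symmetric] clinear_id)

lemma cocycle_term_0: "cocycle_term \<theta> 0 p q = t_eval0 p * t_eval0 q"
  by (simp add: cocycle_term_def t_eval0_mult_bilinear)

text \<open>The operator applied first is split off, because it turns a pure tensor into a
  combination of pure tensors. Inductions on the order run on this recursion.\<close>

lemma cocycle_term_Suc:
  "cocycle_term \<theta> (Suc n) p q = (\<Sum>A\<in>{1, 2}. \<Sum>B\<in>{1, 2}. \<Sum>A'\<in>{3, 4}. \<Sum>B'\<in>{3, 4}.
    (\<i> / 2 * \<theta> A B A' B') * cocycle_term \<theta> n (t_deriv A' A p) (t_deriv B' B q))"
proof -
  note lin = tensor_lift_clinear[OF t_eval0_mult_bilinear] theta_operator_funpow_clinear[of n \<theta>]
  show ?thesis
    unfolding cocycle_term_def funpow_Suc_right comp_apply theta_operator_def[of \<theta> "p \<otimes> q"]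
    by (simp only: lin[THEN clinear_sum] lin[THEN clinear_scale] tensor_map_pure[OF t_deriv_clinear t_deriv_clinear]
        scaleC_complex_def)
qed

lemma cocycle_term_bilinear: "cbilinear (cocycle_term \<theta> n)"
proof (induction n)
  case 0
  show ?case unfolding cocycle_term_0 by (rule t_eval0_mult_bilinear)
next
  case (Suc n)
  note lin = Suc[THEN clinear_cbilinear1] Suc[THEN clinear_cbilinear2]
  show ?case
    unfolding cocycle_term_Suc by (intro clinear_intros lin t_deriv_clinear)
qed

lemma cocycle_term_uminus:
  "cocycle_term (\<lambda>A B A' B'. - \<theta> A B A' B') n p q = (-1) ^ n * cocycle_term \<theta> n p q"
proof (induction n arbitrary: p q)
  case (Suc n)
  show ?case
    unfolding cocycle_term_Suc sum_distrib_left by (intro sum.cong refl) (simp add: Suc)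
qed (simp add: cocycle_term_0)

lemma cocycle_term_zero: "cocycle_term \<theta> n 0 q = 0" "cocycle_term \<theta> n p 0 = 0"
  using cbilinear_simps(2)[OF cocycle_term_bilinear, of \<theta> n 0 0 q]
    cbilinear_simps(4)[OF cocycle_term_bilinear, of \<theta> n p 0 0] by simp_all

text \<open>Each step of the recursion differentiates the first argument and lowers its total
  degree, so an order above the degree gives zero whatever \<open>q\<close> is.\<close>

lemma cocycle_term_single_nilpotent:
  "(\<Sum>v\<in>Poly_Mapping.keys m. Poly_Mapping.lookup m v) < n
    \<Longrightarrow> cocycle_term \<theta> n (Poly_Mapping.single m c) q = 0"
proof (induction n arbitrary: m c q)
  case (Suc n)
  have "cocycle_term \<theta> n (t_deriv A' A (Poly_Mapping.single m c)) q' = 0" for A A' q'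
  \<comment> \<open>If the variable is absent the exponent cannot drop, but then the derivative
    itself is zero.\<close>
  proof (cases "Poly_Mapping.lookup m (Abs_t_var (A, A')) = 0")
    case True
    then show ?thesis
      by (simp add: t_deriv_def mpol_deriv_single cocycle_term_zero)
  next
    case False
    let ?v = "Abs_t_var (A, A')" and ?m = "m - Poly_Mapping.single (Abs_t_var (A, A')) (1 :: nat)"
    have "(\<Sum>v\<in>Poly_Mapping.keys ?m. Poly_Mapping.lookup ?m v)
        = (\<Sum>v\<in>Poly_Mapping.keys m. Poly_Mapping.lookup ?m v)"
      by (intro sum.mono_neutral_left) (auto simp: in_keys_iff lookup_minus)
    also have "\<dots> < (\<Sum>v\<in>Poly_Mapping.keys m. Poly_Mapping.lookup m v)"
      by (rule sum_strict_mono_ex1)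
        (use False in \<open>auto simp: lookup_minus lookup_single in_keys_iff intro!: bexI[of _ ?v]\<close>)
    finally show ?thesis
      using Suc by (simp add: t_deriv_def mpol_deriv_single)
  qed
  then show ?case by (simp add: cocycle_term_Suc)
qed simp

lemma cocycle_term_nilpotent: "\<exists>N. \<forall>n\<ge>N. \<forall>q. cocycle_term \<theta> n p q = 0"
proof (induction p rule: poly_mapping_linear_induct)
  case (1 m c)
  show ?case
    by (rule exI[of _ "Suc (\<Sum>v\<in>Poly_Mapping.keys m. Poly_Mapping.lookup m v)"])
      (auto intro: cocycle_term_single_nilpotent)
next
  case (2 p p')
  then obtain N N' where "\<forall>n\<ge>N. \<forall>q. cocycle_term \<theta> n p q = 0" "\<forall>n\<ge>N'. \<forall>q. cocycle_term \<theta> n p' q = 0"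
    by blast
  then show ?case
    by (intro exI[of _ "max N N'"]) (simp add: cbilinear_simps[OF cocycle_term_bilinear])
qed

text \<open>One truncation index for finitely many first arguments and all second arguments turns
  several exponential series at once into finite sums.\<close>

lemma cocycle_term_nilpotent_uniform:
  "finite S \<Longrightarrow> \<exists>N. \<forall>n\<ge>N. \<forall>p\<in>S. \<forall>q. cocycle_term \<theta> n p q = 0"
proof (induction S rule: finite_induct)
  case (insert p S)
  then obtain N where "\<forall>n\<ge>N. \<forall>p\<in>S. \<forall>q. cocycle_term \<theta> n p q = 0" by blast
  moreover obtain N' where "\<forall>n\<ge>N'. \<forall>q. cocycle_term \<theta> n p q = 0"
    using cocycle_term_nilpotent by blast
  ultimately show ?case
    by (intro exI[of _ "max N N'"]) simp
qed simp

lemma t_cocycle_finite_sum: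
  assumes "\<And>n. n \<ge> N \<Longrightarrow> cocycle_term \<theta> n p q = 0"
  shows "t_cocycle \<theta> p q = (\<Sum>n<N. 1 / fact n * cocycle_term \<theta> n p q)"
  unfolding t_cocycle_eq by (rule suminf_finite) (auto simp: assms)

lemma t_cocycle_bilinear: "cbilinear (t_cocycle \<theta>)"
proof -
  note simps = cbilinear_simps[OF cocycle_term_bilinear] scaleC_complex_def
  \<comment> \<open>With a common truncation index for all four series, bilinearity is inherited
    from the single terms.\<close>
  have fin: "\<exists>N. \<forall>q. t_cocycle \<theta> p q = (\<Sum>n<N. 1 / fact n * cocycle_term \<theta> n p q)
      \<and> t_cocycle \<theta> p' q = (\<Sum>n<N. 1 / fact n * cocycle_term \<theta> n p' q)
      \<and> t_cocycle \<theta> (p + p') q = (\<Sum>n<N. 1 / fact n * cocycle_term \<theta> n (p + p') q)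
      \<and> t_cocycle \<theta> (c *\<^sub>C p) q = (\<Sum>n<N. 1 / fact n * cocycle_term \<theta> n (c *\<^sub>C p) q)" for p p' c
  proof -
    obtain N where "\<forall>n\<ge>N. \<forall>p\<in>{p, p'}. \<forall>q. cocycle_term \<theta> n p q = 0"
      using cocycle_term_nilpotent_uniform[of "{p, p'}" \<theta>] by auto
    then show ?thesis
      by (intro exI[of _ N]) (simp add: simps t_cocycle_finite_sum[of N])
  qed
  show ?thesis
  proof (rule cbilinearI)
    fix p p' q q' c
    show "t_cocycle \<theta> (p + p') q = t_cocycle \<theta> p q + t_cocycle \<theta> p' q"
      using fin[of p p' 0] by (auto simp: simps add_divide_distrib sum.distrib)
    show "t_cocycle \<theta> (c *\<^sub>C p) q = c *\<^sub>C t_cocycle \<theta> p q"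
      using fin[of p p c] by (auto simp: simps sum_distrib_left)
    show "t_cocycle \<theta> p (q + q') = t_cocycle \<theta> p q + t_cocycle \<theta> p q'"
      using fin[of p p 0] by (auto simp: simps add_divide_distrib sum.distrib)
    show "t_cocycle \<theta> p (c *\<^sub>C q) = c *\<^sub>C t_cocycle \<theta> p q"
      using fin[of p p 0] by (auto simp: simps sum_distrib_left)
  qed
qed

section \<open>Values of the cocycle on constants and on generators\<close>

lemma cocycle_term_one_right: "cocycle_term \<theta> (Suc n) p 1 = 0"
  unfolding cocycle_term_Suc by (simp add: t_deriv_def mpol_deriv_one cocycle_term_zero)

lemma cocycle_term_one_left: "cocycle_term \<theta> (Suc n) 1 p = 0"
  unfolding cocycle_term_Suc by (simp add: t_deriv_def mpol_deriv_one cocycle_term_zero)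

text \<open>Derivatives kill constants, which leaves the term of order zero. This normalisation
  later removes the inverse cocycle from the twisted product.\<close>

lemma t_cocycle_one_right: "t_cocycle \<theta> p 1 = t_eval0 p"
proof -
  have "cocycle_term \<theta> n p 1 = 0" if "n \<ge> 1" for n
    using that cocycle_term_one_right by (cases n) auto
  then show ?thesis
    by (simp add: t_cocycle_finite_sum[of 1] cocycle_term_0 algebra_homD[OF t_eval0_algebra_hom])
qed

lemma t_cocycle_one_left: "t_cocycle \<theta> 1 p = t_eval0 p"
proof -
  have "cocycle_term \<theta> n 1 p = 0" if "n \<ge> 1" for n
    using that cocycle_term_one_left by (cases n) auto
  then show ?thesis
    by (simp add: t_cocycle_finite_sum[of 1] cocycle_term_0 algebra_homD[OF t_eval0_algebra_hom])
qed

lemma t_deriv_gen: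
  assumes "A \<in> {1, 2}" "A' \<in> {3, 4}" "B \<in> {1, 2}" "B' \<in> {3, 4}"
  shows "t_deriv A' A (t_gen B B') = (if A = B \<and> A' = B' then 1 else 0)"
  using assms by (auto simp: t_deriv_def t_gen_def mpol_deriv_mvar Abs_t_var_inject)

lemma t_eval0_gen: "t_eval0 (t_gen A A') = 0"
  by (simp add: t_eval0_def t_gen_def)

text \<open>Only the first order survives: generators vanish at zero, and after one derivative both
  arguments are constants.\<close>

lemma t_cocycle_gen:
  assumes "C \<in> {1, 2}" "C' \<in> {3, 4}" "D \<in> {1, 2}" "D' \<in> {3, 4}"
  shows "t_cocycle \<theta> (t_gen C C') (t_gen D D') = \<i> / 2 * \<theta> C D C' D'"
proof -
  have terms: "cocycle_term \<theta> (Suc n) (t_gen C C') (t_gen D D') = \<i> / 2 * \<theta> C D C' D' * cocycle_term \<theta> n 1 1" for n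
    using assms by (auto simp: cocycle_term_Suc t_deriv_gen cocycle_term_zero)
  have "cocycle_term \<theta> n (t_gen C C') (t_gen D D') = 0" if "n \<ge> 2" for n
  proof -
    obtain m where "n = Suc (Suc m)"
      using le_Suc_ex[OF \<open>n \<ge> 2\<close>] by auto
    then show ?thesis by (simp add: terms cocycle_term_one_left)
  qed
  then have "t_cocycle \<theta> (t_gen C C') (t_gen D D')
    = (\<Sum>n<2. 1 / fact n * cocycle_term \<theta> n (t_gen C C') (t_gen D D'))"
    by (rule t_cocycle_finite_sum)
  then show ?thesis
    by (simp add: numeral_2_eq_2 terms cocycle_term_0 t_eval0_gen algebra_homD[OF t_eval0_algebra_hom])
qed

text \<open>The derivatives of the left factor are moved one by one through the coproduct onto
  \<open>p\<close> and \<open>q\<close> by translation invariance. At order zero the left factor is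
  evaluation at zero, the counit of \<open>mpol_comult\<close>.\<close>

lemma cocycle_term_convolution:
  "tensor_lift (\<lambda>p1 p2. tensor_lift (\<lambda>q1 q2. cocycle_term \<theta> n p1 q1 * cocycle_term \<theta> m p2 q2)
    (mpol_comult q)) (mpol_comult p) = cocycle_term \<theta> (n + m) p q"
proof (induction n arbitrary: p q)
  case 0
  have lin: "clinear (cocycle_term \<theta> m p)" "clinear (\<lambda>p. cocycle_term \<theta> m p q)" for p q
    using cocycle_term_bilinear by (simp_all add: cbilinear_iff)
  have "tensor_lift (\<lambda>p1 p2. tensor_lift (\<lambda>q1 q2. cocycle_term \<theta> 0 p1 q1 * cocycle_term \<theta> m p2 q2)
      (mpol_comult q)) (mpol_comult p)
    = tensor_lift (\<lambda>p1 p2. t_eval0 p1 *\<^sub>C tensor_lift (\<lambda>q1 q2. t_eval0 q1 *\<^sub>C cocycle_term \<theta> m p2 q2)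
      (mpol_comult q)) (mpol_comult p)"
    by (simp add: cocycle_term_0 scaleC_complex_def mult.assoc tensor_lift_mult_left)
  then show ?case
    by (simp add: t_eval0_def mpol_comult_counit lin)
next
  case (Suc n)
  note lin = cocycle_term_bilinear[THEN clinear_cbilinear1] cocycle_term_bilinear[THEN clinear_cbilinear2]
  have deriv: "tensor_lift (\<lambda>x y. f (t_deriv A' A x) y) (mpol_comult p) = tensor_lift f (mpol_comult (t_deriv A' A p))"
    if "cbilinear f" for f :: "_ \<Rightarrow> _ \<Rightarrow> complex" and A A' p
    using tensor_lift_tensor_map[OF that mpol_deriv_clinear clinear_ident]
    by (simp add: t_deriv_def flip: mpol_comult_deriv)
  let ?f = "\<lambda>A B A' B' p1 p2 q1 q2. cocycle_term \<theta> n (t_deriv A' A p1) (t_deriv B' B q1) * cocycle_term \<theta> m p2 q2"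
  have step: "tensor_lift (\<lambda>p1 p2. tensor_lift (\<lambda>q1 q2. ?f A B A' B' p1 p2 q1 q2) (mpol_comult q)) (mpol_comult p)
      = cocycle_term \<theta> (n + m) (t_deriv A' A p) (t_deriv B' B q)" for A B A' B'
  proof -
    have "tensor_lift (\<lambda>q1 q2. ?f A B A' B' p1 p2 q1 q2) (mpol_comult q)
      = tensor_lift (\<lambda>q1 q2. cocycle_term \<theta> n (t_deriv A' A p1) q1 * cocycle_term \<theta> m p2 q2)
        (mpol_comult (t_deriv B' B q))" for p1 p2
      by (rule deriv) (intro clinear_intros lin)
    moreover have "tensor_lift (\<lambda>p1 p2. tensor_lift (\<lambda>q1 q2.
          cocycle_term \<theta> n (t_deriv A' A p1) q1 * cocycle_term \<theta> m p2 q2)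
        (mpol_comult (t_deriv B' B q))) (mpol_comult p)
      = tensor_lift (\<lambda>p1 p2. tensor_lift (\<lambda>q1 q2. cocycle_term \<theta> n p1 q1 * cocycle_term \<theta> m p2 q2)
        (mpol_comult (t_deriv B' B q))) (mpol_comult (t_deriv A' A p))"
      by (rule deriv) (intro clinear_intros lin)
    ultimately show ?thesis by (simp add: Suc)
  qed
  have "tensor_lift (\<lambda>p1 p2. tensor_lift (\<lambda>q1 q2. cocycle_term \<theta> (Suc n) p1 q1 * cocycle_term \<theta> m p2 q2)
      (mpol_comult q)) (mpol_comult p)
    = (\<Sum>A\<in>{1, 2}. \<Sum>B\<in>{1, 2}. \<Sum>A'\<in>{3, 4}. \<Sum>B'\<in>{3, 4}. (\<i> / 2 * \<theta> A B A' B') *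
        tensor_lift (\<lambda>p1 p2. tensor_lift (\<lambda>q1 q2. ?f A B A' B' p1 p2 q1 q2) (mpol_comult q)) (mpol_comult p))"
    by (simp only: cocycle_term_Suc sum_distrib_right tensor_lift_sum tensor_lift_mult_left mult.assoc)
  then show ?case
    by (simp only: step cocycle_term_Suc add_Suc)
qed

text \<open>The sum is (1 - 1)^k / k!, expanded by the binomial theorem.\<close>

lemma alternating_exp_coefficients:
  "(\<Sum>i\<le>k. 1 / fact i * ((-1) ^ (k - i) / fact (k - i))) = (if k = 0 then 1 else 0 :: complex)"
  using exp_series_add_commuting[of "1 :: complex" "-1" k]
  by (auto simp: scaleR_conv_of_real divide_inverse mult_ac power_0_left)

lemma t_cocycle_convolution:
  "tensor_lift (\<lambda>p1 p2. tensor_lift (\<lambda>q1 q2. t_cocycle \<theta> p1 q1 * t_cocycle (\<lambda>A B A' B'. - \<theta> A B A' B') p2 q2)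
    (mpol_comult q)) (mpol_comult p) = t_eval0 p * t_eval0 q"
proof -
  let ?K = "Poly_Mapping.keys (rep_tensor (mpol_comult p))"
  \<comment> \<open>The bound must hold for the components of the chosen representative, where the
    series are cut off, and for \<open>p\<close> itself, whose terms of order at least
    \<open>N\<close> are dropped below.\<close>
  have "finite (insert p (fst ` ?K \<union> snd ` ?K))" by simp
  from cocycle_term_nilpotent_uniform[OF this, of \<theta>]
  obtain N where N: "\<And>n x q. n \<ge> N \<Longrightarrow> x \<in> insert p (fst ` ?K \<union> snd ` ?K) \<Longrightarrow> cocycle_term \<theta> n x q = 0"
    by blast
  have nonzero: "k < N" if "cocycle_term \<theta> k p q \<noteq> 0" for k
    using that N[of k p q] by (metis insertI1 not_le)
  let ?a = "\<lambda>n m. 1 / fact n * ((-1) ^ m / fact m) :: complex"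
  \<comment> \<open>The truncation is valid for components from \<open>?K\<close> only, so it is
    applied under the sum over the representative.\<close>
  have terms: "t_cocycle \<theta> p1 q1 * t_cocycle (\<lambda>A B A' B'. - \<theta> A B A' B') p2 q2
      = (\<Sum>n<N. \<Sum>m<N. ?a n m * (cocycle_term \<theta> n p1 q1 * cocycle_term \<theta> m p2 q2))"
    if "(p1, p2) \<in> ?K" for p1 p2 q1 q2
  proof -
    have "p1 \<in> fst ` ?K" "p2 \<in> snd ` ?K" using that by force+
    then have "t_cocycle \<theta> p1 q1 = (\<Sum>n<N. 1 / fact n * cocycle_term \<theta> n p1 q1)"
      "t_cocycle (\<lambda>A B A' B'. - \<theta> A B A' B') p2 q2
        = (\<Sum>m<N. 1 / fact m * cocycle_term (\<lambda>A B A' B'. - \<theta> A B A' B') m p2 q2)"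
      by (intro t_cocycle_finite_sum; simp add: N cocycle_term_uminus)+
    then show ?thesis
      by (simp add: cocycle_term_uminus sum_product mult_ac)
  qed
  have "tensor_lift (\<lambda>p1 p2. tensor_lift (\<lambda>q1 q2. t_cocycle \<theta> p1 q1 * t_cocycle (\<lambda>A B A' B'. - \<theta> A B A' B') p2 q2)
      (mpol_comult q)) (mpol_comult p)
    = tensor_lift (\<lambda>p1 p2. tensor_lift (\<lambda>q1 q2.
        \<Sum>n<N. \<Sum>m<N. ?a n m * (cocycle_term \<theta> n p1 q1 * cocycle_term \<theta> m p2 q2))
      (mpol_comult q)) (mpol_comult p)"
    unfolding tensor_lift_def[of _ "mpol_comult p"] linear_ext_def
    by (rule sum.cong[OF refl]) (auto simp: terms case_prod_beta)
  also have "\<dots> = (\<Sum>n<N. \<Sum>m<N. ?a n m * cocycle_term \<theta> (n + m) p q)"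
    by (simp only: tensor_lift_sum tensor_lift_mult_left cocycle_term_convolution)
  also have "\<dots> = (\<Sum>(n, m)\<in>{..<N} \<times> {..<N}. ?a n m * cocycle_term \<theta> (n + m) p q)"
    by (rule sum.cartesian_product)
  \<comment> \<open>Pairs with \<open>n + m \<ge> N\<close> contribute nothing; the remaining
    triangle is then summed along the diagonals of constant \<open>n + m\<close>.\<close>
  also have "\<dots> = (\<Sum>(n, m)\<in>{(n, m). n + m < N}. ?a n m * cocycle_term \<theta> (n + m) p q)"
    by (rule sum.mono_neutral_right) (auto intro: nonzero)
  also have "\<dots> = (\<Sum>k<N. \<Sum>i\<le>k. ?a i (k - i) * cocycle_term \<theta> (i + (k - i)) p q)"
    by (rule sum.triangle_reindex)
  also have "\<dots> = (\<Sum>k<N. (\<Sum>i\<le>k. ?a i (k - i)) * cocycle_term \<theta> k p q)"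
    by (simp add: sum_distrib_right)
  also have "\<dots> = (\<Sum>k<N. if k = 0 then cocycle_term \<theta> 0 p q else 0)"
    unfolding alternating_exp_coefficients by (intro sum.cong) auto
  \<comment> \<open>For \<open>N = 0\<close> the sum is empty, and the term of order zero vanishes
    by the choice of \<open>N\<close>.\<close>
  also have "\<dots> = cocycle_term \<theta> 0 p q"
    using N[of 0 p q] by (cases N) auto
  finally show ?thesis by (simp add: cocycle_term_0)
qed

section \<open>The coordinate ring of the general linear group\<close>

lemma abs_gl4_algebra_hom: "algebra_hom abs_gl4"
  unfolding algebra_hom_def
  by (auto intro!: clinearI simp: plus_gl4.abs_eq times_gl4.abs_eq scaleC_gl4.abs_eq one_gl4.abs_eq)

text \<open>The entries also determine the value at \<open>gl_det_inv\<close>: it is inverse to the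
  image of the determinant, and inverses are unique.\<close>

lemma algebra_hom_gl4_ext:
  assumes f: "algebra_hom f" and g: "algebra_hom g"
    and entry: "\<And>\<mu> \<nu>. f (gl_entry \<mu> \<nu>) = g (gl_entry \<mu> \<nu>)"
  shows "f x = g x"
proof -
  let ?A = "\<chi> \<mu> \<nu>. gl_entry \<mu> \<nu>"
  have det: "f (det ?A) = g (det ?A)"
    unfolding algebra_hom_det[OF f, symmetric] algebra_hom_det[OF g, symmetric] by (simp add: entry)
  have inv: "f gl_det_inv * f (det ?A) = 1" "g gl_det_inv * g (det ?A) = 1"
    using arg_cong[OF gl_det_inv, of f] arg_cong[OF gl_det_inv, of g]
    by (simp_all only: algebra_homD[OF f] algebra_homD[OF g])
  have "f gl_det_inv = f gl_det_inv * (g gl_det_inv * g (det ?A))"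
    unfolding inv mult_1_right by (rule refl)
  also have "\<dots> = g gl_det_inv * (f gl_det_inv * f (det ?A))"
    unfolding det by (rule mult.left_commute)
  finally have det_inv: "f gl_det_inv = g gl_det_inv"
    unfolding inv mult_1_right .
  obtain p where "x = abs_gl4 p" 
    using Quotient_abs_rep[OF Quotient_gl4, of x] by (rule that[OF sym])
  moreover have "f (abs_gl4 p) = g (abs_gl4 p)"
  proof (rule algebra_hom_mpol_ext)
    show "algebra_hom (\<lambda>p. f (abs_gl4 p))" "algebra_hom (\<lambda>p. g (abs_gl4 p))"
      by (rule algebra_hom_compose[OF f abs_gl4_algebra_hom] algebra_hom_compose[OF g abs_gl4_algebra_hom])+
    show "f (abs_gl4 (mvar v)) = g (abs_gl4 (mvar v))" for v
      using entry det_inv by (cases v) (auto simp: gl_entry.abs_eq gl_det_inv.abs_eq)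
  qed
  ultimately show ?thesis by simp
qed

lemma tensor_lift_gl_comult_entry:
  assumes "cbilinear f"
  shows "tensor_lift f (gl_comult (gl_entry \<mu> \<nu>)) = (\<Sum>\<alpha>\<in>UNIV. f (gl_entry \<mu> \<alpha>) (gl_entry \<alpha> \<nu>))"
  by (simp add: gl_comult_entry clinear_sum[OF tensor_lift_clinear[OF assms]] assms)

lemma cbilinear_algebra_hom_mult:
  "algebra_hom f \<Longrightarrow> algebra_hom g \<Longrightarrow> cbilinear (\<lambda>x y. f x * g y)"
  by (intro clinear_intros algebra_homD(1))

text \<open>Both sides are algebra homomorphisms in \<open>h\<close>, so the claim reduces to
  associativity of matrix multiplication on the entries.\<close>

lemma gl_comult_coassoc:
  "tensor_lift (\<lambda>x z. tensor_lift (\<lambda>x' y. x' \<otimes> y \<otimes> z) (gl_comult x)) (gl_comult h)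
    = tensor_lift (\<lambda>x z. tensor_lift (\<lambda>y z'. x \<otimes> y \<otimes> z') (gl_comult z)) (gl_comult h)"
proof -
  \<comment> \<open>The embeddings into the three tensor factors. Writing a pure tensor as a product
    of their values exhibits the iterated coproducts as homomorphisms.\<close>
  define i1 i2 i3 :: "gl4 \<Rightarrow> (gl4, (gl4, gl4) tensor) tensor"
    where "i1 = (\<lambda>x. x \<otimes> 1)" "i2 = (\<lambda>y. 1 \<otimes> y \<otimes> 1)" "i3 = (\<lambda>z. 1 \<otimes> 1 \<otimes> z)"
  note i_def = i1_i2_i3_def
  have i: "algebra_hom i1" "algebra_hom i2" "algebra_hom i3"
    unfolding i_def
    by (rule algebra_hom_pure_left algebra_hom_compose[OF algebra_hom_pure_right algebra_hom_pure_left]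
        algebra_hom_compose[OF algebra_hom_pure_right algebra_hom_pure_right])+
  have split: "x \<otimes> y \<otimes> z = i1 x * i2 y * i3 z" for x y z
    by (simp add: i_def one_tensor_def tensor_times_pure)
  have L: "algebra_hom (\<lambda>x. tensor_lift (\<lambda>x y. i1 x * i2 y) (gl_comult x))"
    and R: "algebra_hom (\<lambda>x. tensor_lift (\<lambda>y z. i2 y * i3 z) (gl_comult x))"
    by (rule algebra_hom_compose[OF algebra_hom_tensor_lift gl_comult_algebra_hom], (rule i)+)+
  note bil = cbilinear_algebra_hom_mult[OF L i(3)] cbilinear_algebra_hom_mult[OF i(1) R]
    cbilinear_algebra_hom_mult[OF i(1,2)] cbilinear_algebra_hom_mult[OF i(2,3)]
  have "tensor_lift (\<lambda>x z. tensor_lift (\<lambda>x y. i1 x * i2 y) (gl_comult x) * i3 z) (gl_comult h)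
    = tensor_lift (\<lambda>x z. i1 x * tensor_lift (\<lambda>y z. i2 y * i3 z) (gl_comult z)) (gl_comult h)"
  proof (rule algebra_hom_gl4_ext[of _ _ h])
    show "algebra_hom (\<lambda>h. tensor_lift (\<lambda>x z. tensor_lift (\<lambda>x y. i1 x * i2 y) (gl_comult x) * i3 z) (gl_comult h))"
      by (rule algebra_hom_compose[OF algebra_hom_tensor_lift[OF L i(3)] gl_comult_algebra_hom])
    show "algebra_hom (\<lambda>h. tensor_lift (\<lambda>x z. i1 x * tensor_lift (\<lambda>y z. i2 y * i3 z) (gl_comult z)) (gl_comult h))"
      by (rule algebra_hom_compose[OF algebra_hom_tensor_lift[OF i(1) R] gl_comult_algebra_hom])
    fix \<mu> \<nu>
    have "(\<Sum>\<alpha>\<in>UNIV. (\<Sum>\<beta>\<in>UNIV. i1 (gl_entry \<mu> \<beta>) * i2 (gl_entry \<beta> \<alpha>)) * i3 (gl_entry \<alpha> \<nu>))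
      = (\<Sum>\<beta>\<in>UNIV. i1 (gl_entry \<mu> \<beta>) * (\<Sum>\<alpha>\<in>UNIV. i2 (gl_entry \<beta> \<alpha>) * i3 (gl_entry \<alpha> \<nu>)))"
      by (simp only: sum_distrib_left sum_distrib_right mult.assoc) (rule sum.swap)
    then show "tensor_lift (\<lambda>x z. tensor_lift (\<lambda>x y. i1 x * i2 y) (gl_comult x) * i3 z) (gl_comult (gl_entry \<mu> \<nu>))
      = tensor_lift (\<lambda>x z. i1 x * tensor_lift (\<lambda>y z. i2 y * i3 z) (gl_comult z)) (gl_comult (gl_entry \<mu> \<nu>))"
      by (simp only: tensor_lift_gl_comult_entry bil)
  qed
  moreover have "tensor_lift (\<lambda>x z. tensor_lift (\<lambda>x y. i1 x * i2 y) (gl_comult x) * i3 z) (gl_comult h)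
    = tensor_lift (\<lambda>x z. tensor_lift (\<lambda>x' y. x' \<otimes> y \<otimes> z) (gl_comult x)) (gl_comult h)"
    by (simp only: split tensor_lift_mult_right)
  moreover have "tensor_lift (\<lambda>x z. i1 x * tensor_lift (\<lambda>y z. i2 y * i3 z) (gl_comult z)) (gl_comult h)
    = tensor_lift (\<lambda>x z. tensor_lift (\<lambda>y z'. x \<otimes> y \<otimes> z') (gl_comult z)) (gl_comult h)"
    by (simp only: split tensor_lift_mult_left mult.assoc)
  ultimately show ?thesis by simp
qed

lemma gl_comult_counit_left: "tensor_lift (\<lambda>x y. gl_counit x *\<^sub>C y) (gl_comult h) = h"
proof -
  have hom: "algebra_hom (\<lambda>x. gl_counit x *\<^sub>C (1 :: gl4))"
    by (rule algebra_hom_compose[OF algebra_hom_unit gl_counit_algebra_hom])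
  have "tensor_lift (\<lambda>x y. (gl_counit x *\<^sub>C 1) * id y) (gl_comult h) = id h"
    by (rule algebra_hom_gl4_ext[OF algebra_hom_compose[OF algebra_hom_tensor_lift[OF hom algebra_hom_id]
            gl_comult_algebra_hom] algebra_hom_id])
      (simp only: tensor_lift_gl_comult_entry[OF cbilinear_algebra_hom_mult[OF hom algebra_hom_id]],
        simp add: gl_counit_entry scaleC_mult_left if_distrib[of "\<lambda>c. c *\<^sub>C _"]
          if_distrib[of "\<lambda>c. c * _"] scaleC_one cong: if_cong)
  then show ?thesis by (simp add: scaleC_mult_left)
qed

lemma gl_comult_counit_right: "tensor_lift (\<lambda>x y. gl_counit y *\<^sub>C x) (gl_comult h) = h"
proof -
  have hom: "algebra_hom (\<lambda>x. gl_counit x *\<^sub>C (1 :: gl4))"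
    by (rule algebra_hom_compose[OF algebra_hom_unit gl_counit_algebra_hom])
  have "tensor_lift (\<lambda>x y. id x * (gl_counit y *\<^sub>C 1)) (gl_comult h) = id h"
    by (rule algebra_hom_gl4_ext[OF algebra_hom_compose[OF algebra_hom_tensor_lift[OF algebra_hom_id hom]
            gl_comult_algebra_hom] algebra_hom_id])
      (simp only: tensor_lift_gl_comult_entry[OF cbilinear_algebra_hom_mult[OF algebra_hom_id hom]],
        simp add: gl_counit_entry scaleC_mult_right if_distrib[of "\<lambda>c. c *\<^sub>C _"]
          if_distrib[of "\<lambda>c. _ * c"] scaleC_one cong: if_cong)
  then show ?thesis by (simp add: scaleC_mult_right)
qed

lemma GL4_simps: "bmult GL4 = (*)" "bunit GL4 = 1" "bcomult GL4 = gl_comult" "bcounit GL4 = gl_counit"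
  by (simp_all add: GL4_def)

interpretation GL4: coassociative_counital GL4
  by (rule coassociative_counital.intro; unfold GL4_simps;
      rule algebra_homD(1)[OF gl_comult_algebra_hom] algebra_homD(1)[OF gl_counit_algebra_hom]
      gl_comult_coassoc gl_comult_counit_left gl_comult_counit_right)

section \<open>The pulled back cocycle\<close>

text \<open>Block unipotent matrices, with identity diagonal blocks and a free upper right block,
  multiply by adding these blocks; dually, \<open>gl_to_t\<close> respects the coproducts.\<close>

lemma mpol_comult_gl_to_t: "mpol_comult (gl_to_t h) = tensor_map gl_to_t gl_to_t (gl_comult h)"
proof (rule algebra_hom_gl4_ext[of _ _ h])
  show "algebra_hom (\<lambda>h. mpol_comult (gl_to_t h))"
    by (rule algebra_hom_compose[OF mpol_comult_algebra_hom gl_to_t_algebra_hom])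
  note hom = algebra_hom_tensor_map[OF gl_to_t_algebra_hom gl_to_t_algebra_hom]
  show "algebra_hom (\<lambda>h. tensor_map gl_to_t gl_to_t (gl_comult h))"
    by (rule algebra_hom_compose[OF hom gl_comult_algebra_hom])
  note lin = algebra_homD(1)[OF gl_to_t_algebra_hom]
  have gen: "mpol_comult (t_gen A A') = t_gen A A' \<otimes> 1 + 1 \<otimes> t_gen A A'" for A A'
    by (simp add: t_gen_def mpol_comult_mvar)
  have "\<forall>\<mu> \<nu>. mpol_comult (gl_to_t (gl_entry \<mu> \<nu>))
      = (\<Sum>\<alpha>\<in>UNIV. gl_to_t (gl_entry \<mu> \<alpha>) \<otimes> gl_to_t (gl_entry \<alpha> \<nu>))"
    unfolding forall_4 sum_4 gl_to_t_entry
    by (simp add: pure_tensor_zero gen algebra_homD(2,6)[OF mpol_comult_algebra_hom] one_tensor_def add.commute)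
  then show "mpol_comult (gl_to_t (gl_entry \<mu> \<nu>)) = tensor_map gl_to_t gl_to_t (gl_comult (gl_entry \<mu> \<nu>))" for \<mu> \<nu>
    by (simp only: gl_comult_entry algebra_hom_sum[OF hom] tensor_map_pure[OF lin lin])
qed

lemma t_eval0_gl_to_t: "t_eval0 (gl_to_t h) = gl_counit h"
  by (rule algebra_hom_gl4_ext[OF algebra_hom_compose[OF t_eval0_algebra_hom gl_to_t_algebra_hom] gl_counit_algebra_hom])
    (auto simp: gl_to_t_entry gl_counit_entry t_eval0_gen algebra_homD[OF t_eval0_algebra_hom])

abbreviation gl_cocycle :: "(4 \<Rightarrow> 4 \<Rightarrow> 4 \<Rightarrow> 4 \<Rightarrow> complex) \<Rightarrow> gl4 \<Rightarrow> gl4 \<Rightarrow> complex"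
  where "gl_cocycle \<theta> \<equiv> \<lambda>h g. t_cocycle \<theta> (gl_to_t h) (gl_to_t g)"

lemma gl_cocycle_bilinear: "cbilinear (gl_cocycle \<theta>)"
  by (rule cbilinear_comp[OF t_cocycle_bilinear]) (rule algebra_homD(1)[OF gl_to_t_algebra_hom])+

text \<open>A map that respects coproducts carries convolution to convolution, so the claim is
  \<open>t_cocycle_convolution\<close> in the translation coordinates.\<close>

lemma gl_cocycle_convolution:
  "convolution GL4 (gl_cocycle \<theta>) (gl_cocycle (\<lambda>A B A' B'. - \<theta> A B A' B'))
    = (\<lambda>h g. gl_counit h * gl_counit g)"
proof (intro ext)
  fix h g
  let ?\<theta>' = "\<lambda>A B A' B'. - \<theta> A B A' B'"
  note lin = algebra_homD(1)[OF gl_to_t_algebra_hom]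
    t_cocycle_bilinear[THEN clinear_cbilinear1] t_cocycle_bilinear[THEN clinear_cbilinear2]
  have "convolution GL4 (gl_cocycle \<theta>) (gl_cocycle ?\<theta>') h g
    = tensor_lift (\<lambda>p1 p2. tensor_lift (\<lambda>u v. t_cocycle \<theta> p1 (gl_to_t u) * t_cocycle ?\<theta>' p2 (gl_to_t v))
      (gl_comult g)) (mpol_comult (gl_to_t h))"
    unfolding mpol_comult_gl_to_t convolution_def GL4_simps
    by (rule tensor_lift_tensor_map[symmetric]) (intro clinear_intros lin)+
  also have "\<dots> = tensor_lift (\<lambda>p1 p2. tensor_lift (\<lambda>q1 q2. t_cocycle \<theta> p1 q1 * t_cocycle ?\<theta>' p2 q2)
      (mpol_comult (gl_to_t g))) (mpol_comult (gl_to_t h))"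
    unfolding mpol_comult_gl_to_t[of g]
    by (subst tensor_lift_tensor_map) (intro clinear_intros lin | rule refl)+
  finally show "convolution GL4 (gl_cocycle \<theta>) (gl_cocycle ?\<theta>') h g = gl_counit h * gl_counit g"
    by (simp add: t_cocycle_convolution t_eval0_gl_to_t)
qed

text \<open>The inverse law on the other side is the same law for \<open>-\<theta>\<close>.\<close>

lemma gl_cocycle_inverse:
  "convolution_inverse GL4 (gl_cocycle \<theta>) = gl_cocycle (\<lambda>A B A' B'. - \<theta> A B A' B')"
  using gl_cocycle_convolution[of \<theta>] gl_cocycle_convolution[of "\<lambda>A B A' B'. - \<theta> A B A' B'"]
  by (intro GL4.convolution_inverse_eq gl_cocycle_bilinear) (simp_all add: GL4_simps)

lemma t_cocycle_zero: "t_cocycle \<theta> 0 q = 0" "t_cocycle \<theta> p 0 = 0"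
  using cbilinear_simps(2)[OF t_cocycle_bilinear, of \<theta> 0 0 q]
    cbilinear_simps(4)[OF t_cocycle_bilinear, of \<theta> p 0 0] by simp_all

text \<open>The first summand is the product of the counits. The second requires both entries to be
  translation coordinates; if just one is, the other is a constant and the cocycle evaluates a
  generator at zero.\<close>

lemma gl_cocycle_entry:
  "gl_cocycle \<theta> (gl_entry \<mu> \<alpha>) (gl_entry \<nu> \<beta>)
    = (if \<alpha> = \<mu> then if \<beta> = \<nu> then 1 else 0 else 0) + \<i> / 2 * theta_ext \<theta> \<mu> \<nu> \<alpha> \<beta>"
  unfolding gl_to_t_entry theta_ext_def
  by (auto simp: t_cocycle_zero t_cocycle_one_left t_cocycle_one_right t_cocycle_gen t_eval0_gen
      algebra_homD[OF t_eval0_algebra_hom])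

section \<open>The comodule algebra of the first column\<close>

text \<open>Pullback of functions along the orbit map of the first basis vector, whose stabiliser is
  the group of \<open>ktilde\<close>.\<close>

definition first_column :: "4 mpol \<Rightarrow> gl4"
  where "first_column = mpol_hom (\<lambda>\<mu>. gl_entry \<mu> 1)"

lemmas first_column_algebra_hom =
  mpol_hom_algebra_hom[of "\<lambda>\<mu>. gl_entry \<mu> 1", folded first_column_def]

lemma first_column_mvar: "first_column (mvar \<mu>) = gl_entry \<mu> 1"
  by (simp add: first_column_def)

lemmas T_coaction_algebra_hom = mpol_hom_algebra_hom[of "\<lambda>\<mu>. \<Sum>\<alpha>\<in>UNIV. gl_entry \<mu> \<alpha> \<otimes> Z \<alpha>", folded T_coaction_def]

lemma T_coaction_mvar: "T_coaction (mvar \<mu>) = (\<Sum>\<alpha>\<in>UNIV. gl_entry \<mu> \<alpha> \<otimes> mvar \<alpha>)"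
  by (simp add: T_coaction_def Z_def)

text \<open>Dual to the fact that the first column of a product A B is A applied to the first column
  of B.\<close>

lemma gl_comult_first_column: "gl_comult (first_column f) = tensor_map id first_column (T_coaction f)"
proof (rule algebra_hom_mpol_ext[of _ _ f])
  show "algebra_hom (\<lambda>f. gl_comult (first_column f))"
    by (rule algebra_hom_compose[OF gl_comult_algebra_hom first_column_algebra_hom])
  note hom = algebra_hom_tensor_map[OF algebra_hom_id first_column_algebra_hom]
  show "algebra_hom (\<lambda>f. tensor_map id first_column (T_coaction f))"
    by (rule algebra_hom_compose[OF hom T_coaction_algebra_hom])
  note pure = tensor_map_pure[OF clinear_id algebra_homD(1)[OF first_column_algebra_hom]]
  show "gl_comult (first_column (mvar \<mu>)) = tensor_map id first_column (T_coaction (mvar \<mu>))" for \<mu>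
    by (simp only: first_column_mvar T_coaction_mvar gl_comult_entry algebra_hom_sum[OF hom] pure id_apply)
qed

text \<open>Stated for any homomorphism that sends the first column to the first basis vector, since
  it is used both for \<open>k_proj\<close> and for \<open>gl_to_t\<close>.\<close>

lemma first_column_coinvariant:
  assumes "algebra_hom p" "\<And>\<mu>. p (gl_entry \<mu> 1) = (if \<mu> = 1 then 1 else 0)"
  shows "tensor_map id p (gl_comult (first_column f)) = first_column f \<otimes> 1"
proof (rule algebra_hom_mpol_ext[of _ _ f])
  note hom = algebra_hom_tensor_map[OF algebra_hom_id assms(1)]
  show "algebra_hom (\<lambda>f. tensor_map id p (gl_comult (first_column f)))"
    by (rule algebra_hom_compose[OF hom algebra_hom_compose[OF gl_comult_algebra_hom first_column_algebra_hom]])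
  show "algebra_hom (\<lambda>f. first_column f \<otimes> 1)"
    by (rule algebra_hom_compose[OF algebra_hom_pure_left first_column_algebra_hom])
  note pure = tensor_map_pure[OF clinear_id algebra_homD(1)[OF assms(1)]]
  have "tensor_map id p (gl_comult (first_column (mvar \<mu>)))
      = (\<Sum>\<alpha>\<in>UNIV. if \<alpha> = 1 then gl_entry \<mu> \<alpha> \<otimes> 1 else 0)" for \<mu>
    unfolding first_column_mvar gl_comult_entry algebra_hom_sum[OF hom] pure id_apply assms(2)
    by (rule sum.cong) (auto simp: pure_tensor_zero)
  then show "tensor_map id p (gl_comult (first_column (mvar \<mu>))) = first_column (mvar \<mu>) \<otimes> 1" for \<mu>
    by (simp add: first_column_mvar)
qed

text \<open>The outer coproduct becomes the coaction because \<open>first_column\<close> is a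
  comodule map; the inner one contributes \<open>1\<close> in its last factor by
  coinvariance.\<close>

lemma tensor_lift3_first_column:
  assumes "ctrilinear f"
  shows "tensor_lift3 (\<lambda>x y z. f x y (gl_to_t z)) (bcomult3 GL4 (first_column q))
    = tensor_lift (\<lambda>a b. f a (first_column b) 1) (T_coaction q)"
proof -
  note lin = algebra_homD(1)[OF gl_to_t_algebra_hom] algebra_homD(1)[OF gl_comult_algebra_hom]
    algebra_homD(1)[OF first_column_algebra_hom]
  have f: "cbilinear (f x)" "clinear (\<lambda>x. f x y z)" for x y z
    using assms by (auto simp: ctrilinear_def)
  have tri: "ctrilinear (\<lambda>x y z. f x y (gl_to_t z))"
    by (intro ctrilinear_intro clinear_cbilinear1[OF f(1)] clinear_cbilinear2[OF f(1)] f(2) clinear_ident lin)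
  have inner: "tensor_lift (\<lambda>y z. f x y (gl_to_t z)) (gl_comult (first_column b)) = f x (first_column b) 1" for x b
  proof -
    have "tensor_lift (\<lambda>y z. f x y (gl_to_t z)) (gl_comult (first_column b))
      = tensor_lift (f x) (tensor_map id gl_to_t (gl_comult (first_column b)))"
      by (simp add: tensor_lift_tensor_map[OF f(1) clinear_id lin(1)])
    also have "\<dots> = f x (first_column b) 1"
      by (subst first_column_coinvariant[OF gl_to_t_algebra_hom]) (auto simp: gl_to_t_entry f(1))
    finally show ?thesis .
  qed
  have "tensor_lift3 (\<lambda>x y z. f x y (gl_to_t z)) (bcomult3 GL4 (first_column q))
    = tensor_lift (\<lambda>x y. tensor_lift (\<lambda>y z. f x y (gl_to_t z)) (gl_comult y)) (gl_comult (first_column q))"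
    by (simp only: bcomult3_def GL4_simps tensor_lift3_map[OF tri lin(2)])
  also have "\<dots> = tensor_lift (\<lambda>a b. tensor_lift (\<lambda>y z. f a y (gl_to_t z)) (gl_comult (first_column b))) (T_coaction q)"
    unfolding gl_comult_first_column[of q]
    by (subst tensor_lift_tensor_map[OF _ clinear_id lin(3)])
      (simp_all add: cbilinear_comp[OF ctrilinear_lift[OF tri] clinear_ident lin(2)])
  finally show ?thesis by (simp only: inner)
qed

lemma first_column_T_mult:
  "first_column (T_mult \<theta> f g) = bmult (GL4_F \<theta>) (first_column f) (first_column g)"
proof -
  let ?\<theta>' = "\<lambda>A B A' B'. - \<theta> A B A' B'"
  note lin = algebra_homD(1)[OF gl_to_t_algebra_hom] algebra_homD(1)[OF first_column_algebra_hom]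
    algebra_homD(1)[OF t_eval0_algebra_hom]
    t_cocycle_bilinear[THEN clinear_cbilinear1] t_cocycle_bilinear[THEN clinear_cbilinear2]
  \<comment> \<open>The factor \<open>g3\<close> is replaced by \<open>1\<close>, which leaves the
    inverse cocycle as a counit of \<open>h3\<close>; treating \<open>h\<close> in the same way then
    sets that counit to 1.\<close>
  have right: "tensor_lift3 (\<lambda>g1 g2 g3. (gl_cocycle \<theta> h1 g1 * gl_cocycle ?\<theta>' h3 g3) *\<^sub>C (h2 * g2))
      (bcomult3 GL4 (first_column g))
    = tensor_lift (\<lambda>b1 b2. (gl_cocycle \<theta> h1 b1 * t_eval0 (gl_to_t h3)) *\<^sub>C (h2 * first_column b2)) (T_coaction g)"
    for h1 h2 h3
    by (subst tensor_lift3_first_column, intro ctrilinear_intro clinear_intros lin)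
      (simp only: t_cocycle_one_right)
  have "bmult (GL4_F \<theta>) (first_column f) (first_column g)
    = tensor_lift3 (\<lambda>h1 h2 h3. tensor_lift (\<lambda>b1 b2. (gl_cocycle \<theta> h1 b1 * t_eval0 (gl_to_t h3)) *\<^sub>C
        (h2 * first_column b2)) (T_coaction g)) (bcomult3 GL4 (first_column f))"
    unfolding right[symmetric] by (simp add: GL4_F_def twist_def gl_cocycle_inverse GL4_simps)
  also have "\<dots> = tensor_lift (\<lambda>a1 a2. tensor_lift (\<lambda>b1 b2. (gl_cocycle \<theta> a1 b1 * t_eval0 1) *\<^sub>C
        (first_column a2 * first_column b2)) (T_coaction g)) (T_coaction f)"
    by (rule tensor_lift3_first_column) (intro ctrilinear_intro clinear_intros lin)
  also have "\<dots> = first_column (T_mult \<theta> f g)"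
    by (simp add: T_mult_def comodule_twist_def clinear_of_tensor_lift[OF lin(2)]
        algebra_homD[OF first_column_algebra_hom] algebra_homD[OF t_eval0_algebra_hom])
  finally show ?thesis by simp
qed

lemma T_mult_generators:
  "T_mult \<theta> (Z \<mu>) (Z \<nu>) =
    Z \<mu> * Z \<nu> + (\<Sum>a\<in>UNIV. \<Sum>b\<in>UNIV. (\<i> / 2 * theta_ext \<theta> \<mu> \<nu> a b) *\<^sub>C (Z a * Z b))"
proof -
  note lin = gl_cocycle_bilinear[THEN clinear_cbilinear1] gl_cocycle_bilinear[THEN clinear_cbilinear2]
  have coact: "tensor_lift f (T_coaction (Z \<mu>)) = (\<Sum>\<alpha>\<in>UNIV. f (gl_entry \<mu> \<alpha>) (Z \<alpha>))"
    if "cbilinear f" for f :: "gl4 \<Rightarrow> 4 mpol \<Rightarrow> 4 mpol" and \<mu>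
    by (simp add: Z_def T_coaction_mvar clinear_sum[OF tensor_lift_clinear[OF that]] that)
  have "T_mult \<theta> (Z \<mu>) (Z \<nu>)
    = tensor_lift (\<lambda>a1 a2. \<Sum>\<beta>\<in>UNIV. gl_cocycle \<theta> a1 (gl_entry \<nu> \<beta>) *\<^sub>C (a2 * Z \<beta>)) (T_coaction (Z \<mu>))"
    unfolding T_mult_def comodule_twist_def
    by (subst coact) (intro clinear_intros lin | rule refl)+
  also have "\<dots> = (\<Sum>\<alpha>\<in>UNIV. \<Sum>\<beta>\<in>UNIV. gl_cocycle \<theta> (gl_entry \<mu> \<alpha>) (gl_entry \<nu> \<beta>) *\<^sub>C (Z \<alpha> * Z \<beta>))"
    by (rule coact) (intro clinear_intros lin)
  also have "\<dots> = (\<Sum>\<alpha>\<in>UNIV. \<Sum>\<beta>\<in>UNIV. if \<alpha> = \<mu> then if \<beta> = \<nu> then Z \<alpha> * Z \<beta> else 0 else 0)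
    + (\<Sum>\<alpha>\<in>UNIV. \<Sum>\<beta>\<in>UNIV. (\<i> / 2 * theta_ext \<theta> \<mu> \<nu> \<alpha> \<beta>) *\<^sub>C (Z \<alpha> * Z \<beta>))"
    unfolding gl_cocycle_entry sum.distrib[symmetric]
    by (intro sum.cong refl) (simp add: scaleC_add_left scaleC_one)
  also have "(\<Sum>\<alpha>\<in>UNIV. \<Sum>\<beta>\<in>UNIV. if \<alpha> = \<mu> then if \<beta> = \<nu> then Z \<alpha> * Z \<beta> else 0 else 0) = Z \<mu> * Z \<nu>"
    by (subst sum.swap) (simp add: sum.delta)
  finally show ?thesis .
qed

section \<open>Evaluation at points\<close>

text \<open>Kronecker substitution: weighted degrees are made to behave like numerals in a base
  larger than the exponents that occur.\<close>

lemma separating_weight: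
  assumes "finite V" "finite M"
  shows "\<exists>c :: 'v \<Rightarrow> nat. \<forall>m\<in>M. \<forall>m'\<in>M. (\<Sum>v\<in>V. c v * m v) = (\<Sum>v\<in>V. c v * m' v) \<longrightarrow> (\<forall>v\<in>V. m v = m' v)"
  using assms(1)
proof induction
  case (insert v V)
  then obtain c where c: "\<And>m m'. m \<in> M \<Longrightarrow> m' \<in> M \<Longrightarrow> (\<Sum>v\<in>V. c v * m v) = (\<Sum>v\<in>V. c v * m' v) \<Longrightarrow> \<forall>v\<in>V. m v = m' v"
    by blast
  define N where "N = Suc (Max ((\<lambda>m. m v) ` M))"
  have N: "m v < N" if "m \<in> M" for m
    using that assms(2) by (auto simp: N_def less_Suc_eq_le)
  \<comment> \<open>The exponent of \<open>v\<close> becomes the last digit in base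
    \<open>N\<close>, recovered modulo \<open>N\<close>; division by \<open>N\<close> recovers the
    weight for the other variables.\<close>
  let ?c = "\<lambda>u. if u = v then 1 else N * c u"
  have sum: "(\<Sum>u\<in>insert v V. ?c u * m u) = m v + N * (\<Sum>u\<in>V. c u * m u)" for m :: "'v \<Rightarrow> nat"
  proof -
    have "(\<Sum>u\<in>V. ?c u * m u) = (\<Sum>u\<in>V. N * (c u * m u))"
      using insert.hyps by (intro sum.cong) auto
    then show ?thesis
      using insert.hyps by (simp add: sum_distrib_left)
  qed
  have "\<forall>u\<in>insert v V. m u = m' u"
    if m: "m \<in> M" "m' \<in> M" and eq: "(\<Sum>u\<in>insert v V. ?c u * m u) = (\<Sum>u\<in>insert v V. ?c u * m' u)" for m m'
  proof -
    have "m v + N * (\<Sum>u\<in>V. c u * m u) = m' v + N * (\<Sum>u\<in>V. c u * m' u)"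
      using eq by (simp only: sum)
    from arg_cong[OF this, of "\<lambda>k. k mod N"] arg_cong[OF this, of "\<lambda>k. k div N"]
    have "m v = m' v" "(\<Sum>u\<in>V. c u * m u) = (\<Sum>u\<in>V. c u * m' u)"
      using N[OF m(1)] N[OF m(2)] by auto
    then show ?thesis using c[OF m] by auto
  qed
  then show ?case by (intro exI[of _ ?c]) blast
qed simp

text \<open>Substituting \<open>t ^ c v\<close> for the variable \<open>v\<close>, with \<open>c\<close> separating the monomials of \<open>p\<close>, reduces the
  claim to polynomials in \<open>t\<close>.\<close>

lemma mpol_eq_0_on_torus:
  fixes p :: "'v mpol"
  assumes "\<And>x :: 'v \<Rightarrow> complex. (\<And>v. x v \<noteq> 0) \<Longrightarrow> mpol_hom x p = 0"
  shows "p = 0"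
proof -
  let ?K = "Poly_Mapping.keys p"
  define V where "V = (\<Union>k\<in>?K. Poly_Mapping.keys k)"
  have V: "finite V" "\<And>k. k \<in> ?K \<Longrightarrow> Poly_Mapping.keys k \<subseteq> V"
    by (auto simp: V_def)
  obtain c :: "'v \<Rightarrow> nat" where c: "\<And>k l. k \<in> ?K \<Longrightarrow> l \<in> ?K \<Longrightarrow>
      (\<Sum>v\<in>V. c v * Poly_Mapping.lookup k v) = (\<Sum>v\<in>V. c v * Poly_Mapping.lookup l v)
      \<Longrightarrow> \<forall>v\<in>V. Poly_Mapping.lookup k v = Poly_Mapping.lookup l v"
    using separating_weight[OF V(1), of "Poly_Mapping.lookup ` ?K"] by auto
  define w where "w k = (\<Sum>v\<in>V. c v * Poly_Mapping.lookup k v)" for k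
  have inj: "k = l" if "k \<in> ?K" "l \<in> ?K" "w k = w l" for k l
  proof (rule poly_mapping_eqI)
    fix v
    show "Poly_Mapping.lookup k v = Poly_Mapping.lookup l v"
    proof (cases "v \<in> V")
      case True
      then show ?thesis using c[OF that(1,2)] that(3) unfolding w_def by blast
    next
      case False
      then have "v \<notin> Poly_Mapping.keys k" "v \<notin> Poly_Mapping.keys l"
        using V(2) that(1,2) by blast+
      then show ?thesis by (simp add: in_keys_iff)
    qed
  qed
  define q where "q = (\<Sum>k\<in>?K. Polynomial.monom (Poly_Mapping.lookup p k) (w k))"
  have "poly q t = 0" if "t \<noteq> 0" for t
  proof -
    have mono: "(\<Prod>v\<in>Poly_Mapping.keys k. (t ^ c v) ^ Poly_Mapping.lookup k v) = t ^ w k" if "k \<in> ?K" for k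
    proof -
      have "(\<Prod>v\<in>Poly_Mapping.keys k. (t ^ c v) ^ Poly_Mapping.lookup k v)
        = (\<Prod>v\<in>V. (t ^ c v) ^ Poly_Mapping.lookup k v)"
        using V that by (intro prod.mono_neutral_left) (auto simp: in_keys_iff)
      then show ?thesis by (simp add: w_def power_sum power_mult)
    qed
    have "mpol_hom (\<lambda>v. t ^ c v) p = poly q t"
      unfolding mpol_hom_def linear_ext_def q_def poly_sum poly_monom
      by (intro sum.cong) (simp_all add: mono scaleC_complex_def)
    then show ?thesis using assms[of "\<lambda>v. t ^ c v"] that by simp
  qed
  then have "UNIV - {0} \<subseteq> {t. poly q t = 0}" by auto
  moreover have "infinite (UNIV - {0 :: complex})"
    by (simp add: infinite_UNIV_char_0)
  ultimately have "q = 0"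
    using poly_roots_finite finite_subset by blast
  have "Poly_Mapping.lookup p k = 0" for k
  proof (cases "k \<in> ?K")
    case True
    \<comment> \<open>Distinct monomials of \<open>p\<close> have distinct weights, so no
      coefficients merge in \<open>q\<close>.\<close>
    have "coeff q (w k) = (\<Sum>l\<in>?K. if l = k then Poly_Mapping.lookup p l else 0)"
      unfolding q_def coeff_sum coeff_monom using inj True by (intro sum.cong) auto
    then show ?thesis using \<open>q = 0\<close> True by simp
  qed (simp add: in_keys_iff)
  then show ?thesis by (intro poly_mapping_eqI) simp
qed

lemma mpol_hom_compose:
  assumes "algebra_hom f"
  shows "f (mpol_hom w p) = mpol_hom (\<lambda>v. f (w v)) p"
  by (rule algebra_hom_mpol_ext[OF algebra_hom_compose[OF assms mpol_hom_algebra_hom] mpol_hom_algebra_hom])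
    simp

section \<open>Functions on the group as polynomials over powers of the determinant\<close>

abbreviation gl_det :: gl4
  where "gl_det \<equiv> det (\<chi> \<mu> \<nu>. gl_entry \<mu> \<nu>)"

definition gl_poly :: "(4 \<times> 4) mpol \<Rightarrow> gl4"
  where "gl_poly = mpol_hom (\<lambda>(\<mu>, \<nu>). gl_entry \<mu> \<nu>)"

definition generic_det :: "(4 \<times> 4) mpol"
  where "generic_det = det (\<chi> \<mu> \<nu>. mvar (\<mu>, \<nu>))"

lemmas gl_poly_algebra_hom = mpol_hom_algebra_hom[of "\<lambda>(\<mu>, \<nu>). gl_entry \<mu> \<nu>", folded gl_poly_def]

lemma gl_poly_generic_det: "gl_poly generic_det = gl_det"
  unfolding generic_det_def algebra_hom_det[OF gl_poly_algebra_hom, symmetric]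
  by (simp add: gl_poly_def)

lemma mpol_hom_generic_det: "mpol_hom x generic_det = det (\<chi> \<mu> \<nu>. x (\<mu>, \<nu>))"
  unfolding generic_det_def algebra_hom_det[OF mpol_hom_algebra_hom, symmetric] by simp

text \<open>\<open>gl4\<close> is a localisation at the determinant: one factor
  \<open>gl_det\<close> clears the variable \<open>DetInv\<close>, and sums and products multiply
  the denominators.\<close>

lemma gl4_clear_denominator: "\<exists>n p. h * gl_det ^ n = gl_poly p"
proof -
  note hom = algebra_homD[OF gl_poly_algebra_hom] algebra_hom_power[OF gl_poly_algebra_hom]
  note hom' = algebra_homD[OF abs_gl4_algebra_hom]
  have "\<exists>n p. abs_gl4 q * gl_det ^ n = gl_poly p" for q
  proof (induction q rule: mpol_induct)
    case (var v)
    show ?case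
    proof (cases v)
      case (Entry \<mu> \<nu>)
      then show ?thesis
        by (intro exI[of _ 0] exI[of _ "mvar (\<mu>, \<nu>)"]) (simp add: gl_poly_def gl_entry.abs_eq)
    next
      case DetInv
      then show ?thesis
        using gl_det_inv by (intro exI[of _ 1] exI[of _ 1]) (simp add: hom gl_det_inv.abs_eq)
    qed
  next
    case one
    then show ?case
      by (intro exI[of _ 0] exI[of _ 1]) (simp add: hom hom')
  next
    case (scale c q)
    then obtain n p where "abs_gl4 q * gl_det ^ n = gl_poly p" by blast
    then show ?case
      by (intro exI[of _ n] exI[of _ "c *\<^sub>C p"]) (simp add: hom hom' scaleC_mult_left)
  next
    case (add q q')
    then obtain n p n' p' where "abs_gl4 q * gl_det ^ n = gl_poly p" "abs_gl4 q' * gl_det ^ n' = gl_poly p'"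
      by blast
    note eqs = this
    have "abs_gl4 (q + q') * gl_det ^ (n + n')
        = (abs_gl4 q * gl_det ^ n) * gl_det ^ n' + (abs_gl4 q' * gl_det ^ n') * gl_det ^ n"
      by (simp add: hom' power_add algebra_simps)
    also have "\<dots> = gl_poly (p * generic_det ^ n' + p' * generic_det ^ n)"
      unfolding hom gl_poly_generic_det eqs by (rule refl)
    finally show ?case by blast
  next
    case (mult q q')
    then obtain n p n' p' where "abs_gl4 q * gl_det ^ n = gl_poly p" "abs_gl4 q' * gl_det ^ n' = gl_poly p'"
      by blast
    note eqs = this
    have "abs_gl4 (q * q') * gl_det ^ (n + n') = (abs_gl4 q * gl_det ^ n) * (abs_gl4 q' * gl_det ^ n')"
      by (simp add: hom' power_add mult_ac)
    also have "\<dots> = gl_poly (p * p')"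
      unfolding hom eqs by (rule refl)
    finally show ?case by blast
  qed
  moreover obtain q where "h = abs_gl4 q"
    using Quotient_abs_rep[OF Quotient_gl4, of h] by (rule that[OF sym])
  ultimately show ?thesis by simp
qed

lemma gl_point_algebra_hom: "det A \<noteq> 0 \<Longrightarrow> algebra_hom (gl_hom A)" for A :: "complex^4^4"
  by (rule gl_hom_algebra_hom[of "inverse (det A)"]) simp

lemma gl_point_entry: "det A \<noteq> 0 \<Longrightarrow> gl_hom A (gl_entry \<mu> \<nu>) = A $ \<mu> $ \<nu>" for A :: "complex^4^4"
  by (rule gl_hom_entry[of "inverse (det A)"]) simp

lemma gl_point_det: "det A \<noteq> 0 \<Longrightarrow> gl_hom A gl_det = det A" for A :: "complex^4^4"
  by (simp add: gl_point_entry vec_nth_inverse flip: algebra_hom_det[OF gl_point_algebra_hom])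

lemma gl_point_poly:
  fixes A :: "complex^4^4"
  assumes "det A \<noteq> 0"
  shows "gl_hom A (gl_poly p) = mpol_hom (\<lambda>(\<mu>, \<nu>). A $ \<mu> $ \<nu>) p"
  unfolding gl_poly_def mpol_hom_compose[OF gl_point_algebra_hom[OF assms]]
  by (rule arg_cong[of _ _ "\<lambda>w. mpol_hom w p"]) (auto simp: gl_point_entry[OF assms])

lemma gl_point_first_column:
  fixes A :: "complex^4^4"
  assumes "det A \<noteq> 0"
  shows "gl_hom A (first_column f) = mpol_hom (\<lambda>\<mu>. A $ \<mu> $ 1) f"
  unfolding first_column_def mpol_hom_compose[OF gl_point_algebra_hom[OF assms]]
  by (simp add: gl_point_entry[OF assms])

text \<open>Testing only at points with nonzero entries allows the application to divide by an entry
  of the first column.\<close>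

lemma gl4_eq_0_on_points:
  assumes "\<And>A :: complex^4^4. det A \<noteq> 0 \<Longrightarrow> (\<And>\<mu> \<nu>. A $ \<mu> $ \<nu> \<noteq> 0) \<Longrightarrow> gl_hom A h = 0"
  shows "h = 0"
proof -
  obtain n p where p: "h * gl_det ^ n = gl_poly p"
    using gl4_clear_denominator by blast
  \<comment> \<open>The extra factor makes the polynomial vanish also where the matrix is singular;
    in \<open>gl4\<close> it is a unit and is cancelled afterwards.\<close>
  have "p * generic_det = 0"
  proof (rule mpol_eq_0_on_torus)
    fix x :: "4 \<times> 4 \<Rightarrow> complex"
    assume x: "\<And>v. x v \<noteq> 0"
    let ?A = "\<chi> \<mu> \<nu>. x (\<mu>, \<nu>)"
    have "mpol_hom x p = 0" if "det ?A \<noteq> 0"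
    proof -
      have "gl_hom ?A h = 0" by (rule assms[OF that]) (simp add: x)
      then have "gl_hom ?A (gl_poly p) = 0"
        by (simp add: algebra_homD[OF gl_point_algebra_hom[OF that]] flip: p)
      then show ?thesis by (simp add: gl_point_poly[OF that])
    qed
    then show "mpol_hom x (p * generic_det) = 0"
      by (auto simp: algebra_homD[OF mpol_hom_algebra_hom] mpol_hom_generic_det)
  qed
  then have "gl_poly p * gl_det = 0"
    unfolding gl_poly_generic_det[symmetric] algebra_homD(3)[OF gl_poly_algebra_hom, symmetric]
    by (simp add: algebra_homD[OF gl_poly_algebra_hom])
  then have "h * gl_det ^ Suc n = 0"
    unfolding p[symmetric] by (simp add: mult_ac)
  then have "h * (gl_det_inv * gl_det) ^ Suc n = 0"
    unfolding power_mult_distrib mult.left_commute[of h] by simp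
  then show ?thesis by (simp only: gl_det_inv power_one mult_1_right)
qed

section \<open>Coinvariants\<close>

abbreviation coinvariant :: "gl4 \<Rightarrow> bool"
  where "coinvariant h \<equiv> tensor_map id k_proj (gl_comult h) = h \<otimes> 1"

text \<open>Evaluation at a product of matrices is the product of the evaluations after the
  coproduct. As \<open>B\<close> fixes the first basis vector, its evaluation factors through
  \<open>k_proj\<close>, and coinvariance replaces that factor by 1.\<close>

lemma coinvariant_point_mult:
  fixes A B :: "complex^4^4"
  assumes h: "coinvariant h" and A: "det A \<noteq> 0" and B: "det B \<noteq> 0"
    and col: "\<And>\<mu>. B $ \<mu> $ 1 = (if \<mu> = 1 then 1 else 0)"
  shows "gl_hom (A ** B) h = gl_hom A h"
proof -
  note homA = gl_point_algebra_hom[OF A] and homB = gl_point_algebra_hom[OF B]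
  have AB: "det (A ** B) \<noteq> 0" using A B by (simp add: det_mul)
  \<comment> \<open>Evaluation at \<open>B\<close>, descended to \<open>ktilde\<close>; the
    condition on the first column makes it independent of the representative.\<close>
  define k where "k x = gl_hom B (rep_ktilde x)" for x
  have k_proj: "k (k_proj x) = gl_hom B x" for x
    unfolding k_def
    by (rule algebra_hom_ideal[OF homB _ rep_ktilde_proj[unfolded k_ideal_def]])
      (auto simp: algebra_homD[OF homB] gl_point_entry[OF B] col)
  have surj: "\<exists>y. x = k_proj y" for x
    using Quotient_abs_rep[OF Quotient_ktilde, of x] by metis
  have k_lin: "clinear k"
  proof (rule clinearI)
    fix x y c
    obtain x' y' where xy: "x = k_proj x'" "y = k_proj y'" using surj by blast
    show "k (x + y) = k x + k y"
      unfolding xy plus_ktilde.abs_eq k_proj by (rule algebra_homD[OF homB])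
    show "k (c *\<^sub>C x) = c *\<^sub>C k x"
      unfolding xy scaleC_ktilde.abs_eq k_proj by (rule algebra_homD[OF homB])
  qed
  have bil: "cbilinear (\<lambda>a b. gl_hom A a * k b)"
    by (intro clinear_intros k_lin algebra_homD(1)[OF homA])
  have "gl_hom (A ** B) h = tensor_lift (\<lambda>a b. gl_hom A a * gl_hom B b) (gl_comult h)"
  proof (rule algebra_hom_gl4_ext[of _ _ h])
    show "algebra_hom (gl_hom (A ** B))" by (rule gl_point_algebra_hom[OF AB])
    show "algebra_hom (\<lambda>h. tensor_lift (\<lambda>a b. gl_hom A a * gl_hom B b) (gl_comult h))"
      by (rule algebra_hom_compose[OF algebra_hom_tensor_lift[OF homA homB] gl_comult_algebra_hom])
    show "gl_hom (A ** B) (gl_entry \<mu> \<nu>)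
      = tensor_lift (\<lambda>a b. gl_hom A a * gl_hom B b) (gl_comult (gl_entry \<mu> \<nu>))" for \<mu> \<nu>
      unfolding tensor_lift_gl_comult_entry[OF cbilinear_algebra_hom_mult[OF homA homB]]
        gl_point_entry[OF A] gl_point_entry[OF B] gl_point_entry[OF AB]
      by (simp add: matrix_matrix_mult_def)
  qed
  also have "\<dots> = tensor_lift (\<lambda>a b. gl_hom A a * k b) (tensor_map id k_proj (gl_comult h))"
    using tensor_lift_tensor_map[OF bil clinear_id algebra_homD(1)[OF k_proj_algebra_hom]]
    by (simp add: k_proj)
  also have "\<dots> = gl_hom A h"
    unfolding h using k_proj[of 1]
    by (simp add: bil algebra_homD[OF k_proj_algebra_hom] algebra_homD[OF homB])
  finally show ?thesis .
qed

text \<open>If the first columns agree, then the inverse of \<open>A\<close> times \<open>B\<close>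
  fixes the first basis vector.\<close>

lemma coinvariant_point_eq:
  fixes A B :: "complex^4^4"
  assumes h: "coinvariant h" and A: "det A \<noteq> 0" and B: "det B \<noteq> 0"
    and col: "\<And>\<mu>. A $ \<mu> $ 1 = B $ \<mu> $ 1"
  shows "gl_hom A h = gl_hom B h"
proof -
  obtain A' where inv: "A ** A' = mat 1" "A' ** A = mat 1"
    using A unfolding invertible_det_nz[symmetric] invertible_def by blast
  let ?C = "A' ** B"
  have B_eq: "A ** ?C = B"
    by (simp add: matrix_mul_assoc inv)
  have "det ?C \<noteq> 0"
    using B det_mul[of A ?C] by (auto simp: B_eq)
  moreover have "?C $ \<mu> $ 1 = (if \<mu> = 1 then 1 else 0)" for \<mu>
  proof -
    have "?C $ \<mu> $ 1 = (A' ** A) $ \<mu> $ 1"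
      by (simp add: matrix_matrix_mult_def col)
    then show ?thesis by (simp add: inv mat_def)
  qed
  ultimately have "gl_hom (A ** ?C) h = gl_hom A h"
    by (rule coinvariant_point_mult[OF h A])
  then show ?thesis by (simp add: B_eq)
qed

section \<open>Completing a vector to an invertible matrix\<close>

definition swap_matrix :: "4 \<Rightarrow> 'a::comm_ring_1^4^4"
  where "swap_matrix i = (\<chi> \<mu> \<nu>. if Transposition.transpose 1 i \<mu> = \<nu> then 1 else 0)"

text \<open>Columns 2 to 4 of the permutation matrix are all unit vectors but the
  \<open>i\<close>-th, so with first column \<open>x\<close> the determinant is \<open>x i\<close>
  up to sign.\<close>

definition column_matrix :: "4 \<Rightarrow> (4 \<Rightarrow> complex) \<Rightarrow> complex^4^4"
  where "column_matrix i x = (\<chi> \<mu> \<nu>. if \<nu> = 1 then x \<mu> else swap_matrix i $ \<mu> $ \<nu>)"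

lemma det_swap_matrix: "det (swap_matrix i :: complex^4^4) \<noteq> 0"
proof -
  have "swap_matrix i ** swap_matrix i = (mat 1 :: complex^4^4)"
    by (auto simp: swap_matrix_def matrix_matrix_mult_def mat_def vec_eq_iff if_distrib[of "\<lambda>c. c * _"] cong: if_cong)
  from arg_cong[OF this, of det] show ?thesis
    by (auto simp: det_mul)
qed

text \<open>Cramer's rule: \<open>x\<close> is the permutation matrix applied to the permuted vector
  \<open>?y\<close>, whose first coordinate is \<open>x i\<close>.\<close>

lemma det_column_matrix: "det (column_matrix i x) = x i * det (swap_matrix i)"
proof -
  let ?y = "\<chi> \<mu>. x (Transposition.transpose 1 i \<mu>)"
  have y: "(swap_matrix i *v ?y) $ \<mu> = x \<mu>" for \<mu>
    by (simp add: swap_matrix_def matrix_vector_mult_def if_distrib[of "\<lambda>c. c * _"] cong: if_cong)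
  have "column_matrix i x = (\<chi> \<mu> \<nu>. if \<nu> = 1 then (swap_matrix i *v ?y) $ \<mu> else swap_matrix i $ \<mu> $ \<nu>)"
    by (simp only: y column_matrix_def)
  then show ?thesis
    using cramer_lemma[where A = "swap_matrix i" and x = ?y and k = 1] by simp
qed

lemma gl_point_column_matrix:
  "\<exists>n P. \<forall>x. x i \<noteq> 0 \<longrightarrow> x i ^ n * gl_hom (column_matrix i x) h = mpol_hom x P"
proof -
  obtain n p where p: "h * gl_det ^ n = gl_poly p"
    using gl4_clear_denominator by blast
  let ?d = "det (swap_matrix i) :: complex"
  \<comment> \<open>The matrix \<open>column_matrix i x\<close> with variables in place of the
    numbers \<open>x \<mu>\<close>; the constant power of \<open>?d\<close> is absorbed into the
    witness polynomial.\<close>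
  let ?w = "\<lambda>(\<mu>, \<nu>). if \<nu> = 1 then mvar \<mu> else (swap_matrix i $ \<mu> $ \<nu>) *\<^sub>C 1 :: 4 mpol"
  have "x i ^ n * gl_hom (column_matrix i x) h = mpol_hom x ((1 / ?d ^ n) *\<^sub>C mpol_hom ?w p)" if "x i \<noteq> 0" for x
  proof -
    let ?M = "column_matrix i x"
    have M: "det ?M \<noteq> 0" using that det_swap_matrix[of i] by (simp add: det_column_matrix)
    note hom = gl_point_algebra_hom[OF M]
    have "gl_hom ?M h * (x i * ?d) ^ n = gl_hom ?M (h * gl_det ^ n)"
      by (simp add: algebra_homD[OF hom] algebra_hom_power[OF hom] gl_point_det[OF M] det_column_matrix)
    also have "\<dots> = mpol_hom (\<lambda>(\<mu>, \<nu>). ?M $ \<mu> $ \<nu>) p"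
      by (simp only: p gl_point_poly[OF M])
    also have "(\<lambda>(\<mu>, \<nu>). ?M $ \<mu> $ \<nu>) = (\<lambda>v. mpol_hom x (?w v))"
      by (auto simp: column_matrix_def algebra_homD[OF mpol_hom_algebra_hom] scaleC_complex_def)
    also have "mpol_hom (\<lambda>v. mpol_hom x (?w v)) p = mpol_hom x (mpol_hom ?w p)"
      by (rule mpol_hom_compose[OF mpol_hom_algebra_hom, symmetric])
    finally show ?thesis
      using det_swap_matrix[of i]
      by (simp add: algebra_homD[OF mpol_hom_algebra_hom] scaleC_complex_def power_mult_distrib field_simps)
  qed
  then show ?thesis by blast
qed

lemma lookup_monomial_mult:
  "Poly_Mapping.lookup (Poly_Mapping.single a 1 * p) (a + k) = Poly_Mapping.lookup p k" for p :: "'v mpol"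
  by (induction p rule: poly_mapping_linear_induct)
    (simp_all add: mult_single lookup_single when_def distrib_left lookup_add)

text \<open>Multiplication by a power of \<open>u\<close> leaves the exponents of \<open>v\<close>
  unchanged, so every monomial of \<open>P\<close> already has exponent at least \<open>n\<close> in
  \<open>v\<close>.\<close>

lemma mvar_power_dvd:
  fixes P Q :: "'v mpol"
  assumes "v \<noteq> u" and eq: "mvar u ^ m * P = mvar v ^ n * Q"
  shows "\<exists>R. P = mvar v ^ n * R"
proof -
  let ?e = "Poly_Mapping.single v n"
  have ge: "n \<le> Poly_Mapping.lookup k v" if "k \<in> Poly_Mapping.keys P" for k
  proof -
    have "Poly_Mapping.lookup (mvar u ^ m * P) (Poly_Mapping.single u m + k) \<noteq> 0"
      using that by (simp add: mvar_power lookup_monomial_mult in_keys_iff)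
    then have "Poly_Mapping.single u m + k \<in> Poly_Mapping.keys (Poly_Mapping.single ?e 1 * Q)"
      by (simp add: eq in_keys_iff flip: mvar_power)
    then obtain b where "Poly_Mapping.single u m + k = ?e + b"
      using keys_mult[of "Poly_Mapping.single ?e 1" Q] by (auto split: if_splits)
    from arg_cong[OF this, of "\<lambda>k. Poly_Mapping.lookup k v"] show ?thesis
      using \<open>v \<noteq> u\<close> by (simp add: lookup_add lookup_single)
  qed
  have "?e + (k - ?e) = k" if "k \<in> Poly_Mapping.keys P" for k
    using ge[OF that] by (intro poly_mapping_eqI) (auto simp: lookup_add lookup_minus lookup_single when_def)
  then have "P = (\<Sum>k\<in>Poly_Mapping.keys P. Poly_Mapping.single (?e + (k - ?e)) (Poly_Mapping.lookup P k))"
    by (subst poly_mapping_sum_single) simp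
  also have "\<dots> = mvar v ^ n * (\<Sum>k\<in>Poly_Mapping.keys P. Poly_Mapping.single (k - ?e) (Poly_Mapping.lookup P k))"
    by (simp add: mvar_power sum_distrib_left mult_single)
  finally show ?thesis by blast
qed

text \<open>The extension across \<open>x 1 = x 2 = 0\<close> as in Hartogs' theorem; here it amounts to comparing monomials.\<close>

lemma coinvariant_first_column:
  assumes h: "coinvariant h"
  shows "h \<in> range first_column"
proof -
  obtain n P where P: "\<And>x. x 1 \<noteq> 0 \<Longrightarrow> x 1 ^ n * gl_hom (column_matrix 1 x) h = mpol_hom x P"
    using gl_point_column_matrix[of 1] by blast
  obtain m Q where Q: "\<And>x. x 2 \<noteq> 0 \<Longrightarrow> x 2 ^ m * gl_hom (column_matrix 2 x) h = mpol_hom x Q"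
    using gl_point_column_matrix[of 2] by blast
  have col: "column_matrix i x $ \<mu> $ 1 = x \<mu>" for i x \<mu>
    by (simp add: column_matrix_def)
  have det: "det (column_matrix i x) \<noteq> 0" if "x i \<noteq> 0" for i x
    using that det_swap_matrix[of i] by (simp add: det_column_matrix)
  note hom = algebra_homD[OF mpol_hom_algebra_hom] algebra_hom_power[OF mpol_hom_algebra_hom]
  \<comment> \<open>Both completions have the same first column \<open>x\<close>, so the two
    fractions with numerators \<open>P\<close> and \<open>Q\<close> have the same values wherever
    all coordinates are nonzero.\<close>
  have "mvar 2 ^ m * P - mvar 1 ^ n * Q = 0"
  proof (rule mpol_eq_0_on_torus)
    fix x :: "4 \<Rightarrow> complex"
    assume x: "\<And>v. x v \<noteq> 0"
    have "gl_hom (column_matrix 1 x) h = gl_hom (column_matrix 2 x) h"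
      by (rule coinvariant_point_eq[OF h]) (simp_all add: det x col)
    then show "mpol_hom x (mvar 2 ^ m * P - mvar 1 ^ n * Q) = 0"
      by (simp add: hom x flip: P Q)
  qed
  then have "mvar 2 ^ m * P = mvar 1 ^ n * Q" by simp
  then obtain R where R: "P = mvar 1 ^ n * R"
    using mvar_power_dvd[of 1 2 m P n Q] by auto
  have "h - first_column R = 0"
  proof (rule gl4_eq_0_on_points)
    fix A :: "complex^4^4"
    assume A: "det A \<noteq> 0" and entries: "\<And>\<mu> \<nu>. A $ \<mu> $ \<nu> \<noteq> 0"
    let ?x = "\<lambda>\<mu>. A $ \<mu> $ 1"
    have "gl_hom A h = gl_hom (column_matrix 1 ?x) h"
      by (rule coinvariant_point_eq[OF h A]) (simp_all add: det entries col)
    also have "\<dots> = mpol_hom ?x R"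
      using P[of ?x] entries by (simp add: R hom)
    finally show "gl_hom A (h - first_column R) = 0"
      by (simp add: algebra_homD[OF gl_point_algebra_hom[OF A]] gl_point_first_column[OF A])
  qed
  then show ?thesis by auto
qed

text \<open>Every vector with nonzero first coordinate is the first column of an invertible matrix,
  and such vectors separate polynomials.\<close>

lemma inj_first_column: "inj first_column"
proof (rule injI)
  fix f g
  assume eq: "first_column f = first_column g"
  have "f - g = 0"
  proof (rule mpol_eq_0_on_torus)
    fix x :: "4 \<Rightarrow> complex"
    assume "\<And>v. x v \<noteq> 0"
    then have A: "det (column_matrix 1 x) \<noteq> 0"
      using det_swap_matrix[of 1] by (simp add: det_column_matrix)
    have "gl_hom (column_matrix 1 x) (first_column (f - g)) = 0"
      by (simp add: eq algebra_homD[OF first_column_algebra_hom] algebra_homD[OF gl_point_algebra_hom[OF A]])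
    then show "mpol_hom x (f - g) = 0"
      unfolding gl_point_first_column[OF A] by (simp add: column_matrix_def)
  qed
  then show "f = g" by simp
qed

text \<open>Twisting changes the product alone, so the coinvariants are those of the untwisted
  structures.\<close>

lemma right_coinvariants_eq: "right_coinvariants (GL4_F \<theta>) (Ktilde_F \<theta>) k_proj = range first_column"
proof -
  have "right_coinvariants (GL4_F \<theta>) (Ktilde_F \<theta>) k_proj = {h. coinvariant h}"
    by (simp add: right_coinvariants_def GL4_F_def Ktilde_F_def twist_def GL4_def Ktilde_def)
  then show ?thesis
    using coinvariant_first_column first_column_coinvariant[OF k_proj_algebra_hom k_proj_entry] by auto
qed

theorem proposition4p3:
  fixes \<theta> :: "4 \<Rightarrow> 4 \<Rightarrow> 4 \<Rightarrow> 4 \<Rightarrow> complex"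
  shows "(\<forall>\<mu> \<nu>. T_mult \<theta> (Z \<mu>) (Z \<nu>) =
        Z \<mu> * Z \<nu> + (\<Sum>a\<in>UNIV. \<Sum>b\<in>UNIV. (\<i> / 2 * theta_ext \<theta> \<mu> \<nu> a b) *\<^sub>C (Z a * Z b)))
    \<and> is_subalgebra (GL4_F \<theta>) (right_coinvariants (GL4_F \<theta>) (Ktilde_F \<theta>) k_proj)
    \<and> (\<exists>\<phi> :: 4 mpol \<Rightarrow> gl4.
        clinear \<phi> \<and>
        bij_betw \<phi> UNIV (right_coinvariants (GL4_F \<theta>) (Ktilde_F \<theta>) k_proj) \<and>
        \<phi> 1 = bunit (GL4_F \<theta>) \<and>
        (\<forall>f g. \<phi> (T_mult \<theta> f g) = bmult (GL4_F \<theta>) (\<phi> f) (\<phi> g)))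
    \<and> (\<forall>\<mu>. \<forall>\<nu>\<in>{3, 4}. T_mult \<theta> (Z \<mu>) (Z \<nu>) = Z \<mu> * Z \<nu> \<and> T_mult \<theta> (Z \<nu>) (Z \<mu>) = Z \<nu> * Z \<mu>)"
proof (intro conjI)
  note hom = algebra_homD[OF first_column_algebra_hom]
  have unit: "first_column 1 = bunit (GL4_F \<theta>)"
    by (simp add: GL4_F_def twist_def GL4_def hom)
  have "complex_vector.subspace (range first_column)"
    by (rule complex_vector_pair.linear_subspace_image[OF hom(1) complex_vector.subspace_UNIV])
  \<comment> \<open>Closure follows from multiplicativity: the twisted product of two images is the
    image of their \<open>T_mult\<close> product.\<close>
  moreover have "bmult (GL4_F \<theta>) x y \<in> range first_column"
    if "x \<in> range first_column" "y \<in> range first_column" for x y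
    using that by (metis first_column_T_mult rangeE rangeI)
  ultimately show "is_subalgebra (GL4_F \<theta>) (right_coinvariants (GL4_F \<theta>) (Ktilde_F \<theta>) k_proj)"
    unfolding is_subalgebra_def right_coinvariants_eq unit[symmetric] by blast
  show "\<exists>\<phi> :: 4 mpol \<Rightarrow> gl4.
        clinear \<phi> \<and>
        bij_betw \<phi> UNIV (right_coinvariants (GL4_F \<theta>) (Ktilde_F \<theta>) k_proj) \<and>
        \<phi> 1 = bunit (GL4_F \<theta>) \<and>
        (\<forall>f g. \<phi> (T_mult \<theta> f g) = bmult (GL4_F \<theta>) (\<phi> f) (\<phi> g))"
    by (intro exI[of _ first_column] conjI allI hom(1) unit first_column_T_mult)
      (simp add: bij_betw_def inj_first_column right_coinvariants_eq)
  show "\<forall>\<mu> \<nu>. T_mult \<theta> (Z \<mu>) (Z \<nu>) =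
        Z \<mu> * Z \<nu> + (\<Sum>a\<in>UNIV. \<Sum>b\<in>UNIV. (\<i> / 2 * theta_ext \<theta> \<mu> \<nu> a b) *\<^sub>C (Z a * Z b))"
    by (simp only: T_mult_generators simp_thms)
  \<comment> \<open>The first two indices of \<open>theta_ext\<close> must both lie in
    \<open>{1, 2}\<close> for a nonzero value, so one index 3 or 4 removes the correction
    term.\<close>
  have "theta_ext \<theta> \<mu> \<nu> a b = 0" "theta_ext \<theta> \<nu> \<mu> a b = 0" if "\<nu> \<in> {3, 4}" for \<mu> \<nu> a b
    using that by (auto simp: theta_ext_def)
  then show "\<forall>\<mu>. \<forall>\<nu>\<in>{3, 4}. T_mult \<theta> (Z \<mu>) (Z \<nu>) = Z \<mu> * Z \<nu> \<and> T_mult \<theta> (Z \<nu>) (Z \<mu>) = Z \<nu> * Z \<mu>"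
    unfolding T_mult_generators by simp
qed

end
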